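(* Let $\mathbf{k}$ be a commutative ring, $\lambda\in\mathbf{k}$ and $X$ a non-empty set. (a) The bijection $\phi_{\mathcal{L}\mathcal{V},\mathcal{F}_\ell}:\mathcal{L}(X)\cap\mathcal{V}(X)\to\mathcal{F}_\ell(X)$ extends (by $\mathbf{k}$-linearity) to an isomorphism $\phi_{\mathcal{L}\mathcal{V},\mathcal{F}_\ell}:(\mathbf{k}(\mathcal{L}(X)\cap\mathcal{V}(X)),\diamond_v,/\ \backslash)\to(\mathbf{k}\mathcal{F}_\ell(X),\diamond_\ell,\lfloor\ \rfloor)$ of nonunitary Rota–Baxter algebras of weight $\lambda$. (b) The quadruple $(\mathbf{k}\mathcal{F}_\ell(X),\diamond_\ell,\lfloor\ \rfloor,j_X)$ is the free nonunitary Rota–Baxter algebra of weight $\lambda$ on $X$.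
   Context: **Rota–Baxter algebras.** A nonunitary Rota–Baxter algebra of weight $\lambda$ is an associative, not necessarily unitary, $\mathbf{k}$-algebra $A$ with a $\mathbf{k}$-linear operator $P$ satisfying $P(x)P(y)=P(xP(y))+P(P(x)y)+\lambda P(xy)$ for all $x,y\in A$. Morphisms are nonunitary algebra homomorphisms commuting with the operators. The free nonunitary Rota–Baxter algebra of weight $\lambda$ on $X$ is one, $U_X$, with a map of sets $j_X:X\to U_X$ such that for every nonunitary Rota–Baxter algebra $R$ of weight $\lambda$ and map of sets $f:X\to R$ there is a unique morphism $\bar f:U_X\to R$ with $f=\bar f\circ j_X$. For a set $Y$, $\mathbf{k}Y$ is the free $\mathbf{k}$-module with basis $Y$. **Leaf decorated forests.** A planar rooted tree is a finite rooted tree with a fixed planar embedding; a planar rooted forest is a concatenation $T_1\cdots T_b$, $b\ge1$, of such trees. $\mathcal{F}(X)$ is the set of planar rooted forests with leaf vertices decorated by $X$; $\bullet_x$ is the one-vertex tree (its vertex is a leaf) decorated by $x$; the grafting $\lfloor T_1\cdots T_b\rfloor$ adds a new root joined to the roots of $T_1,\dots,T_b$, and is extended linearly. Each tree in $\mathcal{F}(X)$ is either some $\bullet_x$ or $\lfloor\overline F\rfloor$ for a unique forest $\overline F\in\mathcal{F}(X)$. The branches of a vertex are the subtrees rooted at its children; a branch is a leaf branch if it consists of a single vertex, and non-leaf otherwise. $\mathcal{F}_\ell(X)\subseteq\mathcal{F}(X)$ is the set of leaf-spaced forests: the leaf decorated forests that do not have a vertex with adjacent non-leaf branches. $\diamond_\ell$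 is the bilinear product on $\mathbf{k}\mathcal{F}_\ell(X)$ characterized by: (1) if $F,F'$ are leaf decorated trees, then $F\diamond_\ell F'=FF'$ (concatenation) if $F=\bullet_x$ or $F'=\bullet_{x'}$ for some $x,x'\in X$, and $F\diamond_\ell F'=\lfloor\overline F\diamond_\ell F'\rfloor+\lfloor F\diamond_\ell\overline F'\rfloor+\lambda\lfloor\overline F\diamond_\ell\overline F'\rfloor$ if $F=\lfloor\overline F\rfloor$, $F'=\lfloor\overline F'\rfloor$; (2) if $F=F_1\cdots F_b$ and $F'=F'_1\cdots F'_{b'}$ are the decompositions of $F,F'\in\mathcal{F}_\ell(X)$ into leaf decorated trees, then $F\diamond_\ell F'=F_1\cdots F_{b-1}(F_b\diamond_\ell F'_1)F'_2\cdots F'_{b'}$. The map $j_X$ sends $x\in X$ to $\bullet_x$. **Motzkin paths.** A Motzkin path is a lattice path in $\mathbb{N}^2$ (with $\mathbb{N}$ the non-negative integers) from $(0,0)$ to some $(n,0)$, $n\ge0$, with steps $(1,1)$ (up), $(1,-1)$ (down), $(1,0)$ (level). $\mathcal{P}(X)$ is the set of Motzkin paths with level steps decorated by $X$; $\bullet$ is the trivial one-point path; $\ell_x$ is one level step decorated by $x$. $\circ$ is the link product (joining paths end to end), extended multilinearly; $/\,\mathfrak{m}\,\backslash$ adds an up step at the left end and a down step at the right end, extended linearly. A path is indecomposable if it touches the $x$-axis only at its two end vertices; an indecomposable path is $\bullet$, some $\ell_x$, or $/\,\bar{\mathfrak{m}}\,\backslash$. $\mathcal{V}(X)$ is the set of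 valley-free paths (no down step immediately followed by an up step), and $\mathcal{L}(X)$ the set of peak-free paths (not $\bullet$, no up step immediately followed by a down step). $\diamond_v$ is the bilinear product on $\mathbf{k}\mathcal{V}(X)$, restricted to $\mathbf{k}(\mathcal{L}(X)\cap\mathcal{V}(X))$, that is defined recursively with respect to the height of paths and characterized by: (0) $\bullet$ is the identity; (1) for indecomposable $\mathfrak{m},\mathfrak{m}'$ different from $\bullet$, $\mathfrak{m}\diamond_v\mathfrak{m}'=\mathfrak{m}\circ\mathfrak{m}'$ if $\mathfrak{m}=\ell_x$ or $\mathfrak{m}'=\ell_{x'}$ for some $x,x'\in X$, and $\mathfrak{m}\diamond_v\mathfrak{m}'=/\,\bar{\mathfrak{m}}\diamond_v\mathfrak{m}'\,\backslash+/\,\mathfrak{m}\diamond_v\bar{\mathfrak{m}}'\,\backslash+\lambda/\,\bar{\mathfrak{m}}\diamond_v\bar{\mathfrak{m}}'\,\backslash$ if $\mathfrak{m}=/\,\bar{\mathfrak{m}}\,\backslash$, $\mathfrak{m}'=/\,\bar{\mathfrak{m}}'\,\backslash$; (2) $\mathfrak{m}\diamond_v\mathfrak{m}'=\mathfrak{m}_1\circ\cdots\circ\mathfrak{m}_{p-1}\circ(\mathfrak{m}_p\diamond_v\mathfrak{m}'_1)\circ\mathfrak{m}'_2\circ\cdots\circ\mathfrak{m}'_{p'}$ for the decompositions $\mathfrak{m}=\mathfrak{m}_1\circ\cdots\circ\mathfrak{m}_p$, $\mathfrak{m}'=\mathfrak{m}'_1\circ\cdots\circ\mathfrak{m}'_{p'}$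 into indecomposable paths. **The bijection.** $\phi_{\mathcal{L}\mathcal{V},\mathcal{F}_\ell}$ is the restriction to $\mathcal{L}(X)\cap\mathcal{V}(X)$ of the unique semigroup isomorphism $\mathcal{L}(X)\to\mathcal{F}(X)$ (link product to concatenation) that sends each $\ell_x$ to $\bullet_x$ and takes $/\,\mathfrak{m}\,\backslash$ to the grafting of the image of $\mathfrak{m}$.
   Formalization: Leaf-spaced forests are also required to have no two adjacent non-leaf trees at top level (trees count as branches of a virtual root); read literally, ⌊•_x⌋⌊•_x⌋ would be leaf-spaced, so φ would not be onto and grafting would leave F_ℓ(X). *)

theory Defs
  imports "HOL-Library.Poly_Mapping" "HOL-Library.FuncSet"
begin

section \<open>Nonunitary Rota--Baxter algebras\<close>

text \<open>
  The base ring ranges over the sort \<open>{comm_ring, comm_monoid_mult}\<close>, that is, commutative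
  rings with unit. The class \<open>comm_ring_1\<close>, and with it the library locale \<open>module\<close>, would
  exclude the zero ring.

  The operations are required to behave well only on the carrier, which is a subset of an
  arbitrary abelian group.
\<close>

record ('k, 'a) rb_struct =
  carr :: "'a set"
  scale :: "'k \<Rightarrow> 'a \<Rightarrow> 'a"
  mult :: "'a \<Rightarrow> 'a \<Rightarrow> 'a"
  rb_op :: "'a \<Rightarrow> 'a"

locale nonunitary_algebra =
  fixes A :: "('k::{comm_ring, comm_monoid_mult}, 'a::ab_group_add) rb_struct" (structure)
  assumes zero_closed: "0 \<in> carr A"
    and add_closed: "a \<in> carr A \<Longrightarrow> b \<in> carr A \<Longrightarrow> a + b \<in> carr A"
    and uminus_closed: "a \<in> carr A \<Longrightarrow> - a \<in> carr A"
    and scale_closed: "a \<in> carr A \<Longrightarrow> scale A c a \<in> carr A"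
    and scale_add_right: "a \<in> carr A \<Longrightarrow> b \<in> carr A \<Longrightarrow>
          scale A c (a + b) = scale A c a + scale A c b"
    and scale_add_left: "a \<in> carr A \<Longrightarrow> scale A (c + d) a = scale A c a + scale A d a"
    and scale_scale: "a \<in> carr A \<Longrightarrow> scale A c (scale A d a) = scale A (c * d) a"
    and scale_one: "a \<in> carr A \<Longrightarrow> scale A 1 a = a"
    and mult_closed: "a \<in> carr A \<Longrightarrow> b \<in> carr A \<Longrightarrow> mult A a b \<in> carr A"
    and mult_add_left: "a \<in> carr A \<Longrightarrow> a' \<in> carr A \<Longrightarrow> b \<in> carr A \<Longrightarrow>
          mult A (a + a') b = mult A a b + mult A a' b"
    and mult_add_right: "a \<in> carr A \<Longrightarrow> b \<in> carr A \<Longrightarrow> b' \<in> carr A \<Longrightarrow>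
          mult A a (b + b') = mult A a b + mult A a b'"
    and mult_scale_left: "a \<in> carr A \<Longrightarrow> b \<in> carr A \<Longrightarrow>
          mult A (scale A c a) b = scale A c (mult A a b)"
    and mult_scale_right: "a \<in> carr A \<Longrightarrow> b \<in> carr A \<Longrightarrow>
          mult A a (scale A c b) = scale A c (mult A a b)"
    and mult_assoc: "a \<in> carr A \<Longrightarrow> a' \<in> carr A \<Longrightarrow> a'' \<in> carr A \<Longrightarrow>
          mult A (mult A a a') a'' = mult A a (mult A a' a'')"

locale nonunitary_rota_baxter_algebra = nonunitary_algebra A
  for lam :: "'k::{comm_ring, comm_monoid_mult}"
    and A :: "('k, 'a::ab_group_add) rb_struct" (structure) +
  assumes op_closed: "a \<in> carr A \<Longrightarrow> rb_op A a \<in> carr A"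
    and op_add: "a \<in> carr A \<Longrightarrow> b \<in> carr A \<Longrightarrow> rb_op A (a + b) = rb_op A a + rb_op A b"
    and op_scale: "a \<in> carr A \<Longrightarrow> rb_op A (scale A c a) = scale A c (rb_op A a)"
    and rota_baxter: "a \<in> carr A \<Longrightarrow> b \<in> carr A \<Longrightarrow>
          mult A (rb_op A a) (rb_op A b) =
            rb_op A (mult A a (rb_op A b)) + rb_op A (mult A (rb_op A a) b)
              + scale A lam (rb_op A (mult A a b))"

definition rb_morphism ::
  "('k, 'a::ab_group_add) rb_struct \<Rightarrow> ('k, 'b::ab_group_add) rb_struct \<Rightarrow> ('a \<Rightarrow> 'b) \<Rightarrow> bool"
where
  "rb_morphism A B g \<longleftrightarrow>
     g \<in> carr A \<rightarrow> carr B \<and>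
     (\<forall>a\<in>carr A. \<forall>b\<in>carr A. g (a + b) = g a + g b) \<and>
     (\<forall>c. \<forall>a\<in>carr A. g (scale A c a) = scale B c (g a)) \<and>
     (\<forall>a\<in>carr A. \<forall>b\<in>carr A. g (mult A a b) = mult B (g a) (g b)) \<and>
     (\<forall>a\<in>carr A. g (rb_op A a) = rb_op B (g a))"

definition rb_isomorphism ::
  "('k, 'a::ab_group_add) rb_struct \<Rightarrow> ('k, 'b::ab_group_add) rb_struct \<Rightarrow> ('a \<Rightarrow> 'b) \<Rightarrow> bool"
where
  "rb_isomorphism A B g \<longleftrightarrow> rb_morphism A B g \<and> bij_betw g (carr A) (carr B)"

text \<open>
  The type argument is the ambient type of the test algebras \<open>R\<close>; leaving it a type variable in a
  theorem quantifies over all of them. Uniqueness of the induced morphism means uniqueness as a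
  map on the carrier, hence the restriction to extensional functions.
\<close>

definition free_nonunitary_rota_baxter_algebra ::
  "'r::ab_group_add itself \<Rightarrow> 'k::{comm_ring, comm_monoid_mult} \<Rightarrow> 'x set \<Rightarrow>
   ('k, 'a::ab_group_add) rb_struct \<Rightarrow> ('x \<Rightarrow> 'a) \<Rightarrow> bool"
where
  "free_nonunitary_rota_baxter_algebra _ lam X U j \<longleftrightarrow>
     nonunitary_rota_baxter_algebra lam U \<and> j \<in> X \<rightarrow> carr U \<and>
     (\<forall>(R :: ('k, 'r) rb_struct) f.
        nonunitary_rota_baxter_algebra lam R \<longrightarrow> f \<in> X \<rightarrow> carr R \<longrightarrow>
        (\<exists>!g. g \<in> extensional (carr U) \<and> rb_morphism U R g \<and> (\<forall>x\<in>X. f x = g (j x))))"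


section \<open>Free modules and (bi)linear extension\<close>

definition smul :: "'k::{comm_ring, comm_monoid_mult} \<Rightarrow> ('b \<Rightarrow>\<^sub>0 'k) \<Rightarrow> ('b \<Rightarrow>\<^sub>0 'k)" where
  "smul c p = Poly_Mapping.map (\<lambda>d. c * d) p"

definition free_module :: "'b set \<Rightarrow> ('b \<Rightarrow>\<^sub>0 'k::{comm_ring, comm_monoid_mult}) set" where
  "free_module Y = {p. Poly_Mapping.keys p \<subseteq> Y}"

definition basis :: "'b \<Rightarrow> ('b \<Rightarrow>\<^sub>0 'k::{comm_ring, comm_monoid_mult})" where
  "basis b = Poly_Mapping.single b 1"

definition linear_ext ::
  "('b \<Rightarrow> 'c) \<Rightarrow> ('b \<Rightarrow>\<^sub>0 'k::{comm_ring, comm_monoid_mult}) \<Rightarrow> ('c \<Rightarrow>\<^sub>0 'k)" where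
  "linear_ext h p = (\<Sum>b\<in>Poly_Mapping.keys p. smul (Poly_Mapping.lookup p b) (basis (h b)))"

definition bilinear_ext ::
  "('b \<Rightarrow> 'b \<Rightarrow> ('b \<Rightarrow>\<^sub>0 'k::{comm_ring, comm_monoid_mult})) \<Rightarrow>
   ('b \<Rightarrow>\<^sub>0 'k) \<Rightarrow> ('b \<Rightarrow>\<^sub>0 'k) \<Rightarrow> ('b \<Rightarrow>\<^sub>0 'k)" where
  "bilinear_ext h p q =
     (\<Sum>b\<in>Poly_Mapping.keys p. \<Sum>c\<in>Poly_Mapping.keys q.
        smul (Poly_Mapping.lookup p b * Poly_Mapping.lookup q c) (h b c))"


section \<open>Leaf decorated planar rooted forests\<close>

text \<open>
  \<open>Graft []\<close> would be an undecorated leaf, so it is excluded from \<open>trees X\<close>. A forest is the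
  list of its trees, and concatenation of forests is \<open>@\<close>.
\<close>

datatype 'x ptree = Bullet 'x | Graft "'x ptree list"

type_synonym 'x forest = "'x ptree list"

inductive_set trees :: "'x set \<Rightarrow> 'x ptree set" for X :: "'x set" where
  bullet: "x \<in> X \<Longrightarrow> Bullet x \<in> trees X"
| graft: "F \<noteq> [] \<Longrightarrow> (\<forall>T\<in>set F. T \<in> trees X) \<Longrightarrow> Graft F \<in> trees X"

definition forests :: "'x set \<Rightarrow> 'x forest set" where
  "forests X = {F. F \<noteq> [] \<and> set F \<subseteq> trees X}"

fun branches :: "'x ptree \<Rightarrow> 'x ptree list" where
  "branches (Bullet x) = []"
| "branches (Graft F) = F"

text \<open>A vertex of a tree is identified with the subtree rooted at it.\<close>

primrec subtrees :: "'x ptree \<Rightarrow> 'x ptree set" where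
  "subtrees (Bullet x) = {Bullet x}"
| "subtrees (Graft F) = insert (Graft F) (\<Union>(set (map subtrees F)))"

definition single_vertex :: "'x ptree \<Rightarrow> bool" where
  "single_vertex T \<longleftrightarrow> branches T = []"

definition has_adjacent_nonleaf_branches :: "'x ptree \<Rightarrow> bool" where
  "has_adjacent_nonleaf_branches T \<longleftrightarrow>
     (\<exists>i. Suc i < length (branches T) \<and>
        \<not> single_vertex (branches T ! i) \<and> \<not> single_vertex (branches T ! Suc i))"

text \<open>
  The trees of a forest \<open>F\<close> count as branches of one (virtual) root, which is the root of
  \<open>Graft F\<close>: adjacent non-leaf trees at the top level of \<open>F\<close> are forbidden as well. Only so
  is the set closed under grafting and in bijection with the peak-free and valley-free paths.
\<close>

definition leaf_spaced_forests :: "'x set \<Rightarrow> 'x forest set" where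
  "leaf_spaced_forests X =
     {F \<in> forests X. \<forall>T\<in>subtrees (Graft F). \<not> has_adjacent_nonleaf_branches T}"

text \<open>
  \<open>tree_prod\<close> and \<open>forest_prod\<close> are clauses (1) and (2) of the product of leaf-spaced forests,
  on basis elements. The value for an empty forest is irrelevant.
\<close>

function (sequential)
  tree_prod :: "'k::{comm_ring, comm_monoid_mult} \<Rightarrow> 'x ptree \<Rightarrow> 'x ptree \<Rightarrow> ('x forest \<Rightarrow>\<^sub>0 'k)"
and
  forest_prod :: "'k \<Rightarrow> 'x forest \<Rightarrow> 'x forest \<Rightarrow> ('x forest \<Rightarrow>\<^sub>0 'k)"
where
  "tree_prod lam (Graft F) (Graft F') =
     linear_ext (\<lambda>G. [Graft G]) (forest_prod lam F [Graft F'])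
     + linear_ext (\<lambda>G. [Graft G]) (forest_prod lam [Graft F] F')
     + smul lam (linear_ext (\<lambda>G. [Graft G]) (forest_prod lam F F'))"
| "tree_prod lam T T' = basis [T, T']"
| "forest_prod lam F F' =
     (if F = [] \<or> F' = [] then 0
      else linear_ext (\<lambda>G. butlast F @ G @ tl F') (tree_prod lam (last F) (hd F')))"
  by pat_completeness auto

lemma size_mem_less_size_list: "T \<in> set F \<Longrightarrow> size T < size_list size F"
  by (induction F) auto

termination
proof (relation "measure (\<lambda>s. case s of
        Inl (_, T, T') \<Rightarrow> 2 * (size T + size T') + 1
      | Inr (_, F, F') \<Rightarrow> 2 * (size_list size F + size_list size F'))", goal_cases)
  case (5 lam F F')
  then have "size (last F) < size_list size F" and "size (hd F') < size_list size F'"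
    by (simp_all add: size_mem_less_size_list)
  then show ?case by simp
qed auto

declare forest_prod.simps [simp del]

definition graft_op ::
  "('x forest \<Rightarrow>\<^sub>0 'k::{comm_ring, comm_monoid_mult}) \<Rightarrow> ('x forest \<Rightarrow>\<^sub>0 'k)" where
  "graft_op = linear_ext (\<lambda>F. [Graft F])"

definition forest_algebra ::
  "'k::{comm_ring, comm_monoid_mult} \<Rightarrow> 'x set \<Rightarrow> ('k, 'x forest \<Rightarrow>\<^sub>0 'k) rb_struct" where
  "forest_algebra lam X =
     \<lparr>carr = free_module (leaf_spaced_forests X),
      scale = smul,
      mult = bilinear_ext (forest_prod lam),
      rb_op = graft_op\<rparr>"

definition j_map :: "'x \<Rightarrow> ('x forest \<Rightarrow>\<^sub>0 'k::{comm_ring, comm_monoid_mult})" where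
  "j_map x = basis [Bullet x]"


section \<open>Motzkin paths\<close>

datatype 'x step = Up | Down | Level 'x

text \<open>
  A path starting at the origin is the list of its steps: \<open>[]\<close> is the trivial path and the link
  product is \<open>@\<close>.
\<close>

type_synonym 'x path = "'x step list"

primrec rise :: "'x step \<Rightarrow> int" where
  "rise Up = 1"
| "rise Down = -1"
| "rise (Level x) = 0"

definition altitude :: "'x path \<Rightarrow> nat \<Rightarrow> int" where
  "altitude m i = sum_list (map rise (take i m))"

definition motzkin_paths :: "'x set \<Rightarrow> 'x path set" where
  "motzkin_paths X =
     {m. (\<forall>i\<le>length m. 0 \<le> altitude m i) \<and> altitude m (length m) = 0 \<and>
         (\<forall>x. Level x \<in> set m \<longrightarrow> x \<in> X)}"

definition raise_path :: "'x path \<Rightarrow> 'x path" where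
  "raise_path m = Up # m @ [Down]"

definition indecomposable :: "'x path \<Rightarrow> bool" where
  "indecomposable m \<longleftrightarrow> (\<forall>i. 0 < i \<and> i < length m \<longrightarrow> altitude m i \<noteq> 0)"

definition valley_free_paths :: "'x set \<Rightarrow> 'x path set" where
  "valley_free_paths X =
     {m \<in> motzkin_paths X. \<not> (\<exists>i. Suc i < length m \<and> m ! i = Down \<and> m ! Suc i = Up)}"

definition peak_free_paths :: "'x set \<Rightarrow> 'x path set" where
  "peak_free_paths X =
     {m \<in> motzkin_paths X. m \<noteq> [] \<and>
        \<not> (\<exists>i. Suc i < length m \<and> m ! i = Up \<and> m ! Suc i = Down)}"

text \<open>
  The decomposition cuts a path at its returns to the axis. The disjunct \<open>i = length m\<close> is
  redundant for Motzkin paths; it makes the function total.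
\<close>

definition first_return :: "'x path \<Rightarrow> nat" where
  "first_return m = (LEAST i. 0 < i \<and> (altitude m i = 0 \<or> i = length m))"

lemma first_return_pos: "m \<noteq> [] \<Longrightarrow> 0 < first_return m"
  unfolding first_return_def
  by (rule LeastI2[where a = "length m"]) auto

lemma first_return_le: "m \<noteq> [] \<Longrightarrow> first_return m \<le> length m"
  unfolding first_return_def
  by (rule Least_le) auto

function decomposition :: "'x path \<Rightarrow> 'x path list" where
  "decomposition m =
     (if m = [] then []
      else take (first_return m) m # decomposition (drop (first_return m) m))"
  by pat_completeness auto
termination
  by (relation "measure length") (auto simp: first_return_pos)

declare decomposition.simps [simp del]

lemma concat_decomposition: "concat (decomposition m) = m"
proof (induction m rule: decomposition.induct)
  case (1 m)
  then show ?case
    by (cases "m = []") (simp_all add: decomposition.simps[of m] decomposition.simps[of "[]"])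
qed

lemma decomposition_eq_Nil_iff: "decomposition m = [] \<longleftrightarrow> m = []"
  by (simp add: decomposition.simps[of m])

lemma length_le_length_concat: "n \<in> set ns \<Longrightarrow> length n \<le> length (concat ns)"
  by (induction ns) auto

lemma length_decomposition_le: "n \<in> set (decomposition m) \<Longrightarrow> length n \<le> length m"
  using length_le_length_concat[of n "decomposition m"] by (simp add: concat_decomposition)

lemma altitude_take: "altitude (take k m) i = altitude m (min i k)"
  by (simp add: altitude_def)

lemma altitude_drop:
  assumes "k \<le> length m"
  shows "altitude (drop k m) i = altitude m (k + i) - altitude m k"
  by (simp add: altitude_def take_add)

lemma decomposition_indecomposable:
  assumes "m \<in> motzkin_paths X" and "n \<in> set (decomposition m)"
  shows "n \<in> motzkin_paths X \<and> n \<noteq> [] \<and> indecomposable n"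
  using assms
proof (induction m rule: decomposition.induct)
  case (1 m)
  show ?case
  proof (cases "m = []")
    case True
    with "1.prems" show ?thesis by (simp add: decomposition.simps[of "[]"])
  next
    case False
    let ?r = "first_return m"
    have r: "0 < ?r" "?r \<le> length m"
      using False by (simp_all add: first_return_pos first_return_le)
    have "0 < ?r \<and> (altitude m ?r = 0 \<or> ?r = length m)"
      unfolding first_return_def by (rule LeastI[where k = "length m"]) (use False in auto)
    with "1.prems"(1) have r0: "altitude m ?r = 0"
      by (auto simp: motzkin_paths_def)
    have least: "altitude m i \<noteq> 0" if "0 < i" "i < ?r" for i
      using not_less_Least[of i "\<lambda>i. 0 < i \<and> (altitude m i = 0 \<or> i = length m)"] that
      by (auto simp: first_return_def)
    have hd: "take ?r m \<in> motzkin_paths X" "take ?r m \<noteq> []" "indecomposable (take ?r m)"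
      using "1.prems"(1) r r0 least False
      by (auto simp: motzkin_paths_def indecomposable_def altitude_take min_def
          dest: in_set_takeD)
    have tl: "drop ?r m \<in> motzkin_paths X"
      using "1.prems"(1) r r0
      by (auto simp: motzkin_paths_def altitude_drop dest: in_set_dropD)
    from "1.prems"(2) False have "n = take ?r m \<or> n \<in> set (decomposition (drop ?r m))"
      by (simp add: decomposition.simps[of m])
    then show ?thesis
    proof
      assume "n = take ?r m"
      with hd show ?thesis by simp
    next
      assume "n \<in> set (decomposition (drop ?r m))"
      then show ?thesis by (rule "1.IH"[OF False tl])
    qed
  qed
qed

text \<open>The path \<open>m\<close> below \<open>raise_path m\<close>.\<close>

definition lower_path :: "'x path \<Rightarrow> 'x path" where
  "lower_path n = butlast (tl n)"

lemma lower_raise_path [simp]: "lower_path (raise_path m) = m"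
  by (simp add: lower_path_def raise_path_def)

text \<open>
  \<open>indec_prod\<close> is clause (1) of the product of valley-free paths, for indecomposable arguments;
  \<open>path_prod\<close> is clauses (0) and (2).
\<close>

function
  indec_prod :: "'k::{comm_ring, comm_monoid_mult} \<Rightarrow> 'x path \<Rightarrow> 'x path \<Rightarrow> ('x path \<Rightarrow>\<^sub>0 'k)"
and
  path_prod :: "'k \<Rightarrow> 'x path \<Rightarrow> 'x path \<Rightarrow> ('x path \<Rightarrow>\<^sub>0 'k)"
where
  "indec_prod lam n n' =
     (if n = [] \<or> n' = [] \<or> (\<exists>x. n = [Level x]) \<or> (\<exists>x. n' = [Level x]) then basis (n @ n')
      else linear_ext raise_path (path_prod lam (lower_path n) n')
        + linear_ext raise_path (path_prod lam n (lower_path n'))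
        + smul lam (linear_ext raise_path (path_prod lam (lower_path n) (lower_path n'))))"
| "path_prod lam m m' =
     (if m = [] then basis m' else if m' = [] then basis m
      else linear_ext
             (\<lambda>n. concat (butlast (decomposition m)) @ n @ concat (tl (decomposition m')))
             (indec_prod lam (last (decomposition m)) (hd (decomposition m'))))"
  by pat_completeness auto

lemma length_lower_path: "n \<noteq> [] \<Longrightarrow> length (lower_path n) < length n"
  by (cases n) (auto simp: lower_path_def)

termination
proof (relation "measure (\<lambda>s. case s of
        Inl (_, n, n') \<Rightarrow> 2 * (length n + length n')
      | Inr (_, m, m') \<Rightarrow> 2 * (length m + length m') + 1)", goal_cases)
  case (5 lam m m')
  then have "length (last (decomposition m)) \<le> length m"
    and "length (hd (decomposition m')) \<le> length m'"
    by (simp_all add: length_decomposition_le decomposition_eq_Nil_iff)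
  then show ?case by simp
next
  case (4 lam n n')
  then have "length (lower_path n) < length n" and "length (lower_path n') < length n'"
    by (simp_all add: length_lower_path)
  then show ?case by simp
qed (auto dest: length_lower_path)

declare indec_prod.simps [simp del] path_prod.simps [simp del]

definition raise_op ::
  "('x path \<Rightarrow>\<^sub>0 'k::{comm_ring, comm_monoid_mult}) \<Rightarrow> ('x path \<Rightarrow>\<^sub>0 'k)" where
  "raise_op = linear_ext raise_path"

definition path_algebra ::
  "'k::{comm_ring, comm_monoid_mult} \<Rightarrow> 'x set \<Rightarrow> ('k, 'x path \<Rightarrow>\<^sub>0 'k) rb_struct" where
  "path_algebra lam X =
     \<lparr>carr = free_module (peak_free_paths X \<inter> valley_free_paths X),
      scale = smul,
      mult = bilinear_ext (path_prod lam),
      rb_op = raise_op\<rparr>"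


section \<open>The bijection\<close>

definition phi_LF :: "'x set \<Rightarrow> 'x path \<Rightarrow> 'x forest" where
  "phi_LF X =
     (THE h. h \<in> extensional (peak_free_paths X) \<and>
        bij_betw h (peak_free_paths X) (forests X) \<and>
        (\<forall>m\<in>peak_free_paths X. \<forall>m'\<in>peak_free_paths X. h (m @ m') = h m @ h m') \<and>
        (\<forall>x\<in>X. h [Level x] = [Bullet x]) \<and>
        (\<forall>m\<in>peak_free_paths X. h (raise_path m) = [Graft (h m)]))"

definition phi_LV_Fl :: "'x set \<Rightarrow> 'x path \<Rightarrow> 'x forest" where
  "phi_LV_Fl X = restrict (phi_LF X) (peak_free_paths X \<inter> valley_free_paths X)"

end

theory Submission
  imports Defs
begin

text \<open>
  The Rota--Baxter identity is the recursion clause for the product of two grafted trees, so for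
  forests the content lies in associativity. Clause (2) of the product says that only the two
  adjacent trees interact: with the concatenation product \<open>conc\<close> of \<open>k\<close>-linear combinations of
  forests, \<open>A T \<diamond> T' B\<close> is the concatenation of \<open>A\<close>, \<open>T \<diamond> T'\<close> and \<open>B\<close>
  (\<open>forest_prod_conc\<close>). Hence associativity reduces to three single trees. If one of them is a
  leaf, the product with it is concatenation; if all three are grafts, both bracketings expand by
  the Rota--Baxter identity into the same seven grafted terms, up to associativity of smaller
  triples (\<open>fprod_assoc_basis\<close>). This is an argument about all forests; the leaf-spaced ones
  span a submodule closed under the product (\<open>forest_prod_leaf_spaced\<close>), because a
  product of two grafts is a combination of grafts, so it never creates adjacent grafts.

  For the universal property, leaf-spacedness is what makes a morphism unique: adjacent trees of
  a leaf-spaced forest include a leaf, so concatenating them is multiplying them, and every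
  leaf-spaced forest arises from the generators by products and grafting
  (\<open>rb_morphism_eq_on_forest_algebra\<close>). Existence: evaluate a forest in the target algebra,
  reading concatenation as product and grafting as the operator. The product of forests is
  defined by the identities that hold in every Rota--Baxter algebra, so the same recursion shows
  that evaluation is multiplicative (\<open>eval_forest_prod\<close>).

  Walking around a forest, up and down along each inner vertex and level at each leaf, gives the
  map \<open>forest_path\<close>. Cutting a path at its returns to the axis recovers the trees, so it
  is a bijection onto the peak-free paths (\<open>bij_betw_forest_path\<close>), whose inverse has the
  characterizing properties of \<open>phi_LF\<close>; adjacent grafts become valleys. The two recursions
  for the products agree under this map (\<open>path_prod_forest_path\<close>), so the structure on paths
  is a surjective image of the one on forests and inherits the Rota--Baxter axioms.
\<close>

section \<open>Linear extension from a basis\<close>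

locale module_on =
  fixes C :: "'a::ab_group_add set" and scl :: "'k::{comm_ring, comm_monoid_mult} \<Rightarrow> 'a \<Rightarrow> 'a"
  assumes zero_mem: "0 \<in> C"
    and add_mem: "a \<in> C \<Longrightarrow> b \<in> C \<Longrightarrow> a + b \<in> C"
    and scl_mem: "a \<in> C \<Longrightarrow> scl c a \<in> C"
    and scl_add_right: "a \<in> C \<Longrightarrow> b \<in> C \<Longrightarrow> scl c (a + b) = scl c a + scl c b"
    and scl_add_left: "a \<in> C \<Longrightarrow> scl (c + d) a = scl c a + scl d a"
    and scl_scl: "a \<in> C \<Longrightarrow> scl c (scl d a) = scl (c * d) a"
    and scl_one: "a \<in> C \<Longrightarrow> scl 1 a = a"
begin

lemma scl_zero_left: "a \<in> C \<Longrightarrow> scl 0 a = 0"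
  using scl_add_left[of a 0 0] by simp

lemma scl_zero_right: "scl c 0 = 0"
  using scl_add_right[of 0 0 c] zero_mem by simp

lemma sum_mem: "(\<And>i. i \<in> S \<Longrightarrow> h i \<in> C) \<Longrightarrow> sum h S \<in> C"
  by (induction S rule: infinite_finite_induct) (auto simp: zero_mem add_mem)

lemma scl_sum: "(\<And>i. i \<in> S \<Longrightarrow> h i \<in> C) \<Longrightarrow> scl c (sum h S) = (\<Sum>i\<in>S. scl c (h i))"
  by (induction S rule: infinite_finite_induct)
    (auto simp: scl_zero_right scl_add_right sum_mem)

end

text \<open>
  Passing the scalar action as an argument lets one definition serve both the free modules and
  the algebras that live on a proper subset of their ambient type.
\<close>

definition extend ::
  "('k::{comm_ring, comm_monoid_mult} \<Rightarrow> 'a::ab_group_add \<Rightarrow> 'a) \<Rightarrow> ('b \<Rightarrow> 'a) \<Rightarrow> ('b \<Rightarrow>\<^sub>0 'k) \<Rightarrow> 'a"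
where
  "extend scl h p = (\<Sum>b\<in>Poly_Mapping.keys p. scl (Poly_Mapping.lookup p b) (h b))"

lemma lookup_smul [simp]: "Poly_Mapping.lookup (smul c p) b = c * Poly_Mapping.lookup p b"
  by (simp add: smul_def Poly_Mapping.map.rep_eq when_def)

lemma smul_add: "smul c (p + q) = smul c p + smul c q"
  by (rule poly_mapping_eqI) (simp add: lookup_add distrib_left)

lemma smul_add_left: "smul (c + d) p = smul c p + smul d p"
  by (rule poly_mapping_eqI) (simp add: lookup_add distrib_right)

lemma smul_smul: "smul c (smul d p) = smul (c * d) p"
  by (rule poly_mapping_eqI) (simp add: mult.assoc)

lemma smul_one [simp]: "smul 1 p = p"
  by (rule poly_mapping_eqI) simp

lemma smul_zero [simp]: "smul c 0 = 0"
  by (rule poly_mapping_eqI) simp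

interpretation smul: module_on UNIV smul
  by standard (auto simp: smul_add smul_add_left smul_smul)

lemma lookup_basis: "Poly_Mapping.lookup (basis b) c = (if b = c then 1 else 0)"
  by (simp add: basis_def lookup_single when_def)

lemma keys_basis: "Poly_Mapping.keys (basis b) \<subseteq> {b}"
  by (auto simp: in_keys_iff lookup_basis split: if_splits)

lemma keys_smul: "Poly_Mapping.keys (smul c p) \<subseteq> Poly_Mapping.keys p"
  by (auto simp: in_keys_iff)

context module_on
begin

lemma extend_superset:
  assumes "\<And>b. h b \<in> C" and "finite S" and "Poly_Mapping.keys p \<subseteq> S"
  shows "extend scl h p = (\<Sum>b\<in>S. scl (Poly_Mapping.lookup p b) (h b))"
  unfolding extend_def
  by (rule sum.mono_neutral_left) (use assms in \<open>auto simp: in_keys_iff scl_zero_left\<close>)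

lemma extend_mem: "(\<And>b. h b \<in> C) \<Longrightarrow> extend scl h p \<in> C"
  by (simp add: extend_def sum_mem scl_mem)

lemma extend_add:
  assumes h: "\<And>b. h b \<in> C"
  shows "extend scl h (p + q) = extend scl h p + extend scl h q"
proof -
  let ?S = "Poly_Mapping.keys p \<union> Poly_Mapping.keys q"
  have "Poly_Mapping.keys (p + q) \<subseteq> ?S"
    by (rule Poly_Mapping.keys_add)
  then show ?thesis
    using extend_superset[of h ?S, OF h] by (simp add: lookup_add scl_add_left[OF h] sum.distrib)
qed

lemma extend_smul:
  assumes h: "\<And>b. h b \<in> C"
  shows "extend scl h (smul c p) = scl c (extend scl h p)"
  using extend_superset[OF h, of "Poly_Mapping.keys p"]
  by (simp add: keys_smul scl_sum scl_mem h scl_scl)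

lemma extend_basis:
  assumes h: "\<And>b. h b \<in> C"
  shows "extend scl h (basis b) = h b"
  using extend_superset[OF h, of "{b}" "basis b"] by (simp add: keys_basis lookup_basis scl_one h)

end

lemma zero_in_free_module [simp]: "0 \<in> free_module Y"
  and add_in_free_module:
    "p \<in> free_module Y \<Longrightarrow> q \<in> free_module Y \<Longrightarrow> p + q \<in> free_module Y"
  and uminus_in_free_module: "p \<in> free_module Y \<Longrightarrow> - p \<in> free_module Y"
  and smul_in_free_module: "p \<in> free_module Y \<Longrightarrow> smul c p \<in> free_module Y"
  using Poly_Mapping.keys_add[of p q] keys_smul[of c p] by (auto simp: free_module_def)

lemma basis_in_free_module: "b \<in> Y \<Longrightarrow> basis b \<in> free_module Y"
  using keys_basis[of b] by (auto simp: free_module_def)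

lemma free_module_mono: "p \<in> free_module Y \<Longrightarrow> Y \<subseteq> Z \<Longrightarrow> p \<in> free_module Z"
  by (auto simp: free_module_def)

lemma free_module_UNIV [simp]: "p \<in> free_module UNIV"
  by (simp add: free_module_def)

lemma sum_smul_basis:
  "(\<Sum>b\<in>Poly_Mapping.keys p. smul (Poly_Mapping.lookup p b) (basis b)) = p"
proof (rule poly_mapping_eqI)
  fix c
  show "Poly_Mapping.lookup
      (\<Sum>b\<in>Poly_Mapping.keys p. smul (Poly_Mapping.lookup p b) (basis b)) c =
    Poly_Mapping.lookup p c"
    by (simp add: lookup_sum lookup_basis if_distrib[of "(*) _"] in_keys_iff
        cong: if_cong)
qed

text \<open>
  By this rule, identities between linear expressions need to be checked on multiples of basis
  elements only.
\<close>

lemma free_module_induct [consumes 1, case_names zero add gen]: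
  assumes p: "p \<in> free_module Y" and zero: "Q 0"
    and add: "\<And>p q. Q p \<Longrightarrow> Q q \<Longrightarrow> Q (p + q)"
    and gen: "\<And>c b. b \<in> Y \<Longrightarrow> Q (smul c (basis b))"
  shows "Q p"
proof -
  have "Q (\<Sum>b\<in>S. smul (Poly_Mapping.lookup p b) (basis b))" if "finite S" "S \<subseteq> Y" for S
    using that by (induction S rule: finite_induct) (auto intro: zero add gen)
  from this[of "Poly_Mapping.keys p"] p show ?thesis
    by (simp add: sum_smul_basis free_module_def)
qed

lemmas basis_induct [case_names zero add gen] =
  free_module_induct[OF free_module_UNIV, simplified]

lemma linear_ext_extend: "linear_ext h = extend smul (\<lambda>b. basis (h b))"
  by (simp add: fun_eq_iff linear_ext_def extend_def)

text \<open>
  Iterating the one-variable extension makes bilinearity a consequence of linearity of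
  \<open>extend\<close>.
\<close>

lemma bilinear_ext_extend:
  "bilinear_ext h p q = extend smul (\<lambda>b. extend smul (h b) q) p"
  by (simp add: bilinear_ext_def extend_def smul.scl_sum smul_smul)

lemma linear_ext_simps:
  "linear_ext h 0 = 0"
  "linear_ext h (p + q) = linear_ext h p + linear_ext h q"
  "linear_ext h (smul c p) = smul c (linear_ext h p)"
  "linear_ext h (basis b) = basis (h b)"
  by (simp_all add: linear_ext_extend smul.extend_add smul.extend_smul smul.extend_basis)
    (simp add: extend_def)

lemma extend_smul_add_fun:
  "extend smul (\<lambda>b. h b + k b) p = extend smul h p + extend smul k p"
  by (simp add: extend_def smul_add sum.distrib)

lemma extend_smul_smul_fun: "extend smul (\<lambda>b. smul c (h b)) p = smul c (extend smul h p)"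
  by (simp add: extend_def smul_smul smul.scl_sum mult.commute)

lemma bilinear_ext_simps:
  "bilinear_ext h 0 q = 0"
  "bilinear_ext h p 0 = 0"
  "bilinear_ext h (p + p') q = bilinear_ext h p q + bilinear_ext h p' q"
  "bilinear_ext h p (q + q') = bilinear_ext h p q + bilinear_ext h p q'"
  "bilinear_ext h (smul c p) q = smul c (bilinear_ext h p q)"
  "bilinear_ext h p (smul c q) = smul c (bilinear_ext h p q)"
  "bilinear_ext h (basis b) (basis b') = h b b'"
  by (simp_all add: bilinear_ext_extend smul.extend_add smul.extend_smul smul.extend_basis
      extend_smul_add_fun extend_smul_smul_fun)
    (simp_all add: extend_def)

lemma linear_ext_compose: "linear_ext h (linear_ext k p) = linear_ext (\<lambda>b. h (k b)) p"
  by (induction p rule: basis_induct) (simp_all add: linear_ext_simps)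

lemma linear_ext_cong_on:
  assumes "p \<in> free_module Y" and "\<And>b. b \<in> Y \<Longrightarrow> h b = k b"
  shows "linear_ext h p = linear_ext k p"
  using assms by (induction p rule: free_module_induct) (simp_all add: linear_ext_simps)

lemma linear_ext_id: "linear_ext (\<lambda>b. b) p = p"
  by (induction p rule: basis_induct) (simp_all add: linear_ext_simps)

lemma linear_ext_in_free_module:
  assumes "p \<in> free_module Y" and "\<And>b. b \<in> Y \<Longrightarrow> h b \<in> Z"
  shows "linear_ext h p \<in> free_module Z"
  using assms
  by (induction p rule: free_module_induct)
    (simp_all add: linear_ext_simps add_in_free_module smul_in_free_module basis_in_free_module)

lemma bilinear_ext_in_free_module:
  assumes "p \<in> free_module Y" and "q \<in> free_module Z"
    and "\<And>b c. b \<in> Y \<Longrightarrow> c \<in> Z \<Longrightarrow> h b c \<in> free_module W"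
  shows "bilinear_ext h p q \<in> free_module W"
  using assms(1)
proof (induction p rule: free_module_induct)
  case (gen c b)
  from assms(2) show ?case
    by (induction q rule: free_module_induct)
      (simp_all add: bilinear_ext_simps add_in_free_module smul_in_free_module assms(3) gen)
qed (simp_all add: bilinear_ext_simps add_in_free_module)


section \<open>The product of forests is associative\<close>

text \<open>
  Extending concatenation bilinearly lets the prefixes and suffixes carried along by the product
  of forests be moved around by associativity.
\<close>

definition conc :: "('a list \<Rightarrow>\<^sub>0 'k::{comm_ring, comm_monoid_mult}) \<Rightarrow> ('a list \<Rightarrow>\<^sub>0 'k) \<Rightarrow>
    ('a list \<Rightarrow>\<^sub>0 'k)" where
  "conc = bilinear_ext (\<lambda>F G. basis (F @ G))"

lemmas conc_simps =
  bilinear_ext_simps[where h = "\<lambda>F G. basis (F @ G)", folded conc_def]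

abbreviation fprod :: "'k::{comm_ring, comm_monoid_mult} \<Rightarrow> ('x forest \<Rightarrow>\<^sub>0 'k) \<Rightarrow>
    ('x forest \<Rightarrow>\<^sub>0 'k) \<Rightarrow> ('x forest \<Rightarrow>\<^sub>0 'k)" where
  "fprod lam \<equiv> bilinear_ext (forest_prod lam)"

lemma conc_Nil [simp]: "conc (basis []) p = p" "conc p (basis []) = p"
  by (induction p rule: basis_induct) (simp_all add: conc_simps)

lemma conc_assoc: "conc (conc p q) r = conc p (conc q r)"
proof (induction p rule: basis_induct)
  case (gen c F)
  show ?case
  proof (induction q rule: basis_induct)
    case (gen c G)
    show ?case
      by (induction r rule: basis_induct) (simp_all add: conc_simps)
  qed (simp_all add: conc_simps smul_add)
qed (simp_all add: conc_simps)

lemma linear_ext_append: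
  "linear_ext (\<lambda>G. F @ G @ H) p = conc (basis F) (conc p (basis H))"
  by (induction p rule: basis_induct)
    (simp_all add: conc_simps linear_ext_simps)

lemma forest_prod_conc:
  "forest_prod lam (F @ [T]) (T' # F') =
     conc (basis F) (conc (tree_prod lam T T') (basis F'))"
  by (simp add: forest_prod.simps linear_ext_append)

lemma forest_prod_singleton: "forest_prod lam [T] [T'] = tree_prod lam T T'"
  using forest_prod_conc[of lam "[]" T T' "[]"] by simp

lemma forest_prod_Nil [simp]: "forest_prod lam [] F = 0" "forest_prod lam F [] = 0"
  by (simp_all add: forest_prod.simps)

lemma fprod_Nil: "fprod lam (basis []) p = 0" "fprod lam p (basis []) = 0"
  by (induction p rule: basis_induct) (simp_all add: bilinear_ext_simps)

lemma forest_prod_append_left: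
  "G \<noteq> [] \<Longrightarrow> forest_prod lam (F @ G) H = conc (basis F) (forest_prod lam G H)"
proof (cases H)
  case (Cons T' H')
  assume "G \<noteq> []"
  then obtain G' T where "G = G' @ [T]"
    using rev_exhaust by blast
  with Cons show ?thesis
    using forest_prod_conc[of lam "F @ G'" T T' H'] forest_prod_conc[of lam G' T T' H']
    by (simp add: conc_assoc flip: conc_simps(7))
qed (simp add: conc_simps)

lemma forest_prod_append_right:
  "G \<noteq> [] \<Longrightarrow> forest_prod lam F (G @ H) = conc (forest_prod lam F G) (basis H)"
proof (cases F rule: rev_cases)
  case (snoc F' T)
  assume "G \<noteq> []"
  then obtain G' T' where "G = T' # G'"
    by (cases G) auto
  with snoc show ?thesis
    using forest_prod_conc[of lam F' T T' G'] forest_prod_conc[of lam F' T T' "G' @ H"]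
    by (simp add: conc_assoc flip: conc_simps(7))
qed (simp add: conc_simps)

text \<open>
  A factor on the far side of a nonempty forest does not take part in the product. For an empty
  forest this fails, since the product with the empty list is \<open>0\<close>.
\<close>

lemma fprod_conc_left:
  assumes "q \<in> free_module {G. G \<noteq> []}"
  shows "fprod lam (conc p q) r = conc p (fprod lam q r)"
proof (induction p rule: basis_induct)
  case (gen c F)
  from assms show ?case
  proof (induction q rule: free_module_induct)
    case (gen c G)
    then show ?case
      by (induction r rule: basis_induct)
        (simp_all add: conc_simps bilinear_ext_simps forest_prod_append_left smul_add)
  qed (simp_all add: conc_simps bilinear_ext_simps smul_add)
qed (simp_all add: conc_simps bilinear_ext_simps)

lemma fprod_conc_right:
  assumes "q \<in> free_module {G. G \<noteq> []}"
  shows "fprod lam p (conc q r) = conc (fprod lam p q) r"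
proof (induction p rule: basis_induct)
  case (gen c F)
  from assms show ?case
  proof (induction q rule: free_module_induct)
    case (gen c G)
    then show ?case
      by (induction r rule: basis_induct)
        (simp_all add: conc_simps bilinear_ext_simps forest_prod_append_right smul_add)
  qed (simp_all add: conc_simps bilinear_ext_simps smul_add)
qed (simp_all add: conc_simps bilinear_ext_simps)

lemma graft_op_simps:
  "graft_op 0 = 0" "graft_op (p + q) = graft_op p + graft_op q"
  "graft_op (smul c p) = smul c (graft_op p)" "graft_op (basis F) = basis [Graft F]"
  by (simp_all add: graft_op_def linear_ext_simps)

lemma tree_prod_Graft:
  "tree_prod lam (Graft F) (Graft F') =
     graft_op (forest_prod lam F [Graft F']) + graft_op (forest_prod lam [Graft F] F')
     + smul lam (graft_op (forest_prod lam F F'))"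
  by (simp add: graft_op_def)

lemma fprod_rota_baxter:
  "fprod lam (graft_op p) (graft_op q) =
     graft_op (fprod lam p (graft_op q)) + graft_op (fprod lam (graft_op p) q)
     + smul lam (graft_op (fprod lam p q))"
proof (induction p rule: basis_induct)
  case (gen c F)
  show ?case
    by (induction q rule: basis_induct)
      (simp_all add: graft_op_simps bilinear_ext_simps forest_prod_singleton tree_prod_Graft
        smul_add smul_smul ac_simps del: tree_prod.simps)
qed (simp_all add: graft_op_simps bilinear_ext_simps smul_add ac_simps)

lemma graft_op_nonempty: "graft_op p \<in> free_module {G. G \<noteq> []}"
  unfolding graft_op_def by (rule linear_ext_in_free_module[where Y = UNIV]) auto

lemma tree_prod_nonempty: "tree_prod lam T T' \<in> free_module {G. G \<noteq> []}"
  by (cases T; cases T')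
    (auto simp: tree_prod_Graft intro!: add_in_free_module smul_in_free_module graft_op_nonempty
      basis_in_free_module simp del: tree_prod.simps(1))

lemma forest_prod_nonempty: "forest_prod lam F F' \<in> free_module {G. G \<noteq> []}"
proof -
  have "linear_ext (\<lambda>G. butlast F @ G @ tl F') (tree_prod lam (last F) (hd F'))
      \<in> free_module {G. G \<noteq> []}"
    by (rule linear_ext_in_free_module[OF tree_prod_nonempty]) auto
  then show ?thesis
    by (auto simp: forest_prod.simps)
qed

text \<open>
  A leaf turns the product into concatenation, because clause (1) does so for trees.
\<close>

lemma fprod_Bullet_left:
  assumes "p \<in> free_module {G. G \<noteq> []}"
  shows "fprod lam (basis [Bullet x]) p = conc (basis [Bullet x]) p"
  using assms
proof (induction p rule: free_module_induct)
  case (gen c G)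
  then obtain T H where "G = T # H"
    by (cases G) auto
  then show ?case
    using forest_prod_conc[of lam "[]" "Bullet x" T H]
    by (simp add: bilinear_ext_simps conc_simps)
qed (simp_all add: bilinear_ext_simps conc_simps)

lemma fprod_Bullet_right:
  assumes "p \<in> free_module {G. G \<noteq> []}"
  shows "fprod lam p (basis [Bullet x]) = conc p (basis [Bullet x])"
  using assms
proof (induction p rule: free_module_induct)
  case (gen c G)
  then obtain T H where "G = H @ [T]"
    using rev_exhaust by blast
  then show ?case
    using forest_prod_conc[of lam H T "Bullet x" "[]"]
    by (cases T) (simp_all add: bilinear_ext_simps conc_simps)
qed (simp_all add: bilinear_ext_simps conc_simps)

text \<open>
  The induction is on the total size. Splitting off the trees that do not interact leaves three
  single trees. If all are grafts, \<open>P(a) P(b) P(c)\<close> expands with the Rota--Baxter identity,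
  used once inside and once outside; the terms in which a product \<open>P(a) P(b)\<close> was expanded
  recombine to \<open>P(P(a) P(b) c)\<close>, and every resulting triple has lost at least one graft. A middle
  forest of at least two trees separates the interaction on its left from that on its right.
\<close>

lemma fprod_assoc_basis:
  fixes F G H :: "'x forest"
  shows "fprod lam (fprod lam (basis F) (basis G)) (basis H) =
   fprod lam (basis F) (fprod lam (basis G) (basis H))"
proof (induction "size_list size F + size_list size G + size_list size H"
    arbitrary: F G H rule: less_induct)
  case less
  note nonempty = basis_in_free_module[of _ "{G. G \<noteq> []}", simplified]
  have fprod_nonempty: "fprod lam (basis F) (basis G) \<in> free_module {G. G \<noteq> []}" for F G :: "'x forest"
    by (simp add: bilinear_ext_simps forest_prod_nonempty)
  have trees: "fprod lam (fprod lam (basis [R]) (basis [S])) (basis [T]) =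
      fprod lam (basis [R]) (fprod lam (basis [S]) (basis [T]))"
    if size: "size R + size S + size T + 3 \<le> size_list size F + size_list size G + size_list size H"
    for R S T :: "'x ptree"
  proof (cases "(\<exists>x. R = Bullet x) \<or> (\<exists>x. S = Bullet x) \<or> (\<exists>x. T = Bullet x)")
    case True
    then consider x where "R = Bullet x" | x where "S = Bullet x" | x where "T = Bullet x"
      by blast
    then show ?thesis
    proof cases
      case 1
      then show ?thesis
        by (simp add: fprod_Bullet_left nonempty fprod_nonempty fprod_conc_left)
    next
      case 2
      then show ?thesis
        by (simp add: fprod_Bullet_left fprod_Bullet_right nonempty fprod_conc_left
            fprod_conc_right conc_assoc)
    next
      case 3
      then show ?thesis
        by (simp add: fprod_Bullet_right nonempty fprod_nonempty fprod_conc_right)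
    qed
  next
    case False
    then obtain A B C where RST: "R = Graft A" "S = Graft B" "T = Graft C"
      by (metis ptree.exhaust)
    let ?a = "basis A" and ?b = "basis B" and ?c = "basis C"
    \<comment> \<open>the seven triples in which at least one factor has lost its root\<close>
    have IH: "fprod lam (fprod lam ?a (graft_op ?b)) (graft_op ?c) =
          fprod lam ?a (fprod lam (graft_op ?b) (graft_op ?c))"
        "fprod lam (fprod lam (graft_op ?a) ?b) (graft_op ?c) =
          fprod lam (graft_op ?a) (fprod lam ?b (graft_op ?c))"
        "fprod lam (fprod lam (graft_op ?a) (graft_op ?b)) ?c =
          fprod lam (graft_op ?a) (fprod lam (graft_op ?b) ?c)"
        "fprod lam (fprod lam ?a ?b) (graft_op ?c) = fprod lam ?a (fprod lam ?b (graft_op ?c))"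
        "fprod lam (fprod lam ?a (graft_op ?b)) ?c = fprod lam ?a (fprod lam (graft_op ?b) ?c)"
        "fprod lam (fprod lam (graft_op ?a) ?b) ?c = fprod lam (graft_op ?a) (fprod lam ?b ?c)"
        "fprod lam (fprod lam ?a ?b) ?c = fprod lam ?a (fprod lam ?b ?c)"
      unfolding graft_op_simps by (rule less; use size in \<open>simp add: RST\<close>)+
    have "fprod lam (fprod lam (graft_op ?a) (graft_op ?b)) (graft_op ?c) =
        graft_op (fprod lam (fprod lam ?a (graft_op ?b)) (graft_op ?c))
        + graft_op (fprod lam (fprod lam (graft_op ?a) ?b) (graft_op ?c))
        + graft_op (fprod lam (fprod lam (graft_op ?a) (graft_op ?b)) ?c)
        + smul lam (graft_op (fprod lam (fprod lam ?a ?b) (graft_op ?c)))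
        + smul lam (graft_op (fprod lam (fprod lam ?a (graft_op ?b)) ?c))
        + smul lam (graft_op (fprod lam (fprod lam (graft_op ?a) ?b) ?c))
        + smul lam (smul lam (graft_op (fprod lam (fprod lam ?a ?b) ?c)))"
      by (simp add: fprod_rota_baxter bilinear_ext_simps graft_op_simps smul_add ac_simps
          del: graft_op_simps(4))
    also have "\<dots> = fprod lam (graft_op ?a) (fprod lam (graft_op ?b) (graft_op ?c))"
      unfolding IH
      by (simp add: fprod_rota_baxter bilinear_ext_simps graft_op_simps smul_add ac_simps
          del: graft_op_simps(4))
    finally show ?thesis
      by (simp add: graft_op_simps RST)
  qed
  show ?case
  proof (cases "F = [] \<or> G = [] \<or> H = []")
    case True
    then show ?thesis
      by (auto simp: fprod_Nil bilinear_ext_simps(1,2))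
  next
    case False
    then obtain S G' where G: "G = S # G'"
      by (cases G) auto
    show ?thesis
    proof (cases "G' = []")
      case True
      from False obtain F' R H' T where F: "F = F' @ [R]" and H: "H = T # H'"
        by (metis neq_Nil_conv rev_exhaust)
      have "size R + size S + size T + 3 \<le> size_list size F + size_list size G + size_list size H"
        by (simp add: F G H)
      note assoc = trees[OF this]
      \<comment> \<open>the outer trees of \<open>F\<close> and \<open>H\<close> pass through both products\<close>
      have F': "basis F = conc (basis F') (basis [R])" and H': "basis H = conc (basis [T]) (basis H')"
        by (simp_all add: F H conc_simps)
      show ?thesis
        unfolding F' H' G True
        by (simp add: fprod_conc_left fprod_conc_right nonempty fprod_nonempty assoc)
    next
      case False
      have G_conc: "basis G = conc (basis [S]) (basis G')"
        by (simp add: G conc_simps)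
      from False show ?thesis
        by (simp add: G_conc fprod_conc_left fprod_conc_right nonempty)
    qed
  qed
qed

lemma fprod_assoc: "fprod lam (fprod lam p q) r = fprod lam p (fprod lam q r)"
proof (induction p rule: basis_induct)
  case (gen c F)
  show ?case
  proof (induction q rule: basis_induct)
    case (gen c G)
    show ?case
      by (induction r rule: basis_induct)
        (simp_all add: bilinear_ext_simps(1-6) fprod_assoc_basis)
  qed (simp_all add: bilinear_ext_simps smul_add)
qed (simp_all add: bilinear_ext_simps)


section \<open>Leaf-spaced forests\<close>

fun is_Bullet :: "'x ptree \<Rightarrow> bool" where
  "is_Bullet (Bullet x) = True"
| "is_Bullet (Graft F) = False"

lemma forests_simps:
  "[Bullet x] \<in> forests X \<longleftrightarrow> x \<in> X"
  "[Graft F] \<in> forests X \<longleftrightarrow> F \<in> forests X"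
  "F \<noteq> [] \<Longrightarrow> G \<noteq> [] \<Longrightarrow> F @ G \<in> forests X \<longleftrightarrow> F \<in> forests X \<and> G \<in> forests X"
  by (auto simp: forests_def trees.simps[of "Bullet x"] trees.simps[of "Graft F"])

lemma Nil_notin_forests [simp]: "[] \<notin> forests X"
  by (simp add: forests_def)

text \<open>
  \<open>single_vertex\<close> would also hold of a graft of the empty forest, which membership in
  \<open>forests X\<close> excludes.
\<close>

lemma has_adjacent_nonleaf_branches_iff:
  assumes "F \<in> forests X"
  shows "has_adjacent_nonleaf_branches (Graft F) \<longleftrightarrow>
    \<not> successively (\<lambda>S T. is_Bullet S \<or> is_Bullet T) F"
proof -
  have "single_vertex T \<longleftrightarrow> is_Bullet T" if "T \<in> trees X" for T
    using that by cases (auto simp: single_vertex_def)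
  then have "single_vertex (F ! i) \<longleftrightarrow> is_Bullet (F ! i)" if "i < length F" for i
    using assms nth_mem[OF that] by (simp add: forests_def subset_iff)
  then show ?thesis
    by (auto simp: has_adjacent_nonleaf_branches_def successively_conv_nth)
qed

lemma leaf_spaced_iff:
  assumes "F \<in> forests X"
  shows "F \<in> leaf_spaced_forests X \<longleftrightarrow>
    successively (\<lambda>S T. is_Bullet S \<or> is_Bullet T) F \<and>
    (\<forall>T\<in>set F. \<forall>S\<in>subtrees T. \<not> has_adjacent_nonleaf_branches S)"
  using assms by (auto simp: leaf_spaced_forests_def has_adjacent_nonleaf_branches_iff)

lemma leaf_spaced_in_forests: "F \<in> leaf_spaced_forests X \<Longrightarrow> F \<in> forests X"
  by (simp add: leaf_spaced_forests_def)

lemma leaf_spaced_Bullet [simp]: "[Bullet x] \<in> leaf_spaced_forests X \<longleftrightarrow> x \<in> X"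
  by (auto simp: leaf_spaced_forests_def forests_simps has_adjacent_nonleaf_branches_def)

lemma leaf_spaced_Graft [simp]: "[Graft F] \<in> leaf_spaced_forests X \<longleftrightarrow> F \<in> leaf_spaced_forests X"
  by (auto simp: leaf_spaced_forests_def forests_simps)
    (auto simp: has_adjacent_nonleaf_branches_def)

text \<open>
  Leaf-spacedness of a concatenation depends on the two parts and on the two trees that meet;
  together with the rules for leaves and grafts this replaces the condition on all vertices.
\<close>

lemma leaf_spaced_append:
  assumes "F \<noteq> []" and "G \<noteq> []"
  shows "F @ G \<in> leaf_spaced_forests X \<longleftrightarrow>
    F \<in> leaf_spaced_forests X \<and> G \<in> leaf_spaced_forests X \<and> (is_Bullet (last F) \<or> is_Bullet (hd G))"
proof (cases "F @ G \<in> forests X")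
  case True
  with assms have "F \<in> forests X" "G \<in> forests X"
    by (simp_all add: forests_simps)
  with True assms show ?thesis
    by (auto simp: leaf_spaced_iff successively_append_iff)
next
  case False
  with assms show ?thesis
    by (auto dest!: leaf_spaced_in_forests simp: forests_simps)
qed

lemma forests_induct [consumes 1, case_names Bullet Graft append]:
  assumes "F \<in> forests X"
    and Bullet: "\<And>x. x \<in> X \<Longrightarrow> Q [Bullet x]"
    and Graft: "\<And>F. F \<in> forests X \<Longrightarrow> Q F \<Longrightarrow> Q [Graft F]"
    and append: "\<And>T F. [T] \<in> forests X \<Longrightarrow> F \<in> forests X \<Longrightarrow> Q [T] \<Longrightarrow> Q F \<Longrightarrow> Q (T # F)"
  shows "Q F"
  using assms(1)
proof (induction "size_list size F" arbitrary: F rule: less_induct)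
  case less
  then obtain T G where F: "F = T # G"
    by (cases F) auto
  show ?case
  proof (cases "G = []")
    case True
    show ?thesis
    proof (cases T)
      case (Bullet x)
      with True F less.prems show ?thesis
        by (simp add: forests_simps assms(2))
    next
      case (Graft H)
      with True F less show ?thesis
        by (simp add: forests_simps assms(3))
    qed
  next
    case False
    with less.prems F have "[T] \<in> forests X" "G \<in> forests X"
      using forests_simps(3)[of "[T]" G X] by simp_all
    moreover have "size_list size [T] < size_list size F" "size_list size G < size_list size F"
      using False by (cases G; simp add: F)+
    ultimately show ?thesis
      unfolding F by (blast intro: append[of T G] less.hyps[unfolded F])
  qed
qed

text \<open>
  The conditions on the first and the last tree are what allows the product to be put back
  between the neighbours of \<open>T\<close> and \<open>T'\<close>: next to a graft there was a leaf already, and where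
  \<open>T\<close> or \<open>T'\<close> is a leaf, the product still begins or ends with one. The third assumption is
  the induction hypothesis of the lemma that follows.
\<close>

lemma tree_prod_leaf_spaced:
  fixes lam :: "'k::{comm_ring, comm_monoid_mult}" and T T' :: "'x ptree"
  assumes "[T] \<in> leaf_spaced_forests X" and "[T'] \<in> leaf_spaced_forests X"
    and "\<And>F F'. T = Graft F \<Longrightarrow> T' = Graft F' \<Longrightarrow>
      forest_prod lam F [T'] \<in> free_module (leaf_spaced_forests X) \<and>
      forest_prod lam [T] F' \<in> free_module (leaf_spaced_forests X) \<and>
      forest_prod lam F F' \<in> free_module (leaf_spaced_forests X)"
  shows "tree_prod lam T T' \<in> free_module {G \<in> leaf_spaced_forests X.
    (is_Bullet T \<longrightarrow> is_Bullet (hd G)) \<and> (is_Bullet T' \<longrightarrow> is_Bullet (last G))}"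
    (is "_ \<in> free_module ?Y")
proof (cases "is_Bullet T \<or> is_Bullet T'")
  case True
  then have "tree_prod lam T T' = basis [T, T']"
    by (cases T; cases T') auto
  moreover have "[T, T'] \<in> ?Y"
    using leaf_spaced_append[of "[T]" "[T']" X] assms(1,2) True by simp
  ultimately show ?thesis
    by (simp add: basis_in_free_module)
next
  case False
  then obtain F F' where T: "T = Graft F" "T' = Graft F'"
    by (metis is_Bullet.simps(1) ptree.exhaust)
  have "graft_op p \<in> free_module ?Y" if "p \<in> free_module (leaf_spaced_forests X)"
    for p :: "'x forest \<Rightarrow>\<^sub>0 'k"
    unfolding graft_op_def by (rule linear_ext_in_free_module[OF that]) (simp add: T)
  then show ?thesis
    using assms(3)[OF T] unfolding T tree_prod_Graft
    by (intro add_in_free_module smul_in_free_module) auto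
qed

lemma forest_prod_leaf_spaced:
  assumes "F \<in> leaf_spaced_forests X" and "F' \<in> leaf_spaced_forests X"
  shows "forest_prod lam F F' \<in> free_module (leaf_spaced_forests X)"
  using assms
proof (induction "size_list size F + size_list size F'" arbitrary: F F' rule: less_induct)
  case less
  have "F \<noteq> []" "F' \<noteq> []"
    using less.prems by (auto dest: leaf_spaced_in_forests)
  then obtain A T T' B where F: "F = A @ [T]" and F': "F' = T' # B"
    by (metis neq_Nil_conv rev_exhaust)
  have T: "[T] \<in> leaf_spaced_forests X" "A \<noteq> [] \<Longrightarrow> A \<in> leaf_spaced_forests X"
      "A \<noteq> [] \<Longrightarrow> is_Bullet (last A) \<or> is_Bullet T"
    using less.prems(1) leaf_spaced_append[of A "[T]" X] by (cases "A = []"; simp add: F)+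
  have T': "[T'] \<in> leaf_spaced_forests X" "B \<noteq> [] \<Longrightarrow> B \<in> leaf_spaced_forests X"
      "B \<noteq> [] \<Longrightarrow> is_Bullet T' \<or> is_Bullet (hd B)"
    using less.prems(2) leaf_spaced_append[of "[T']" B X] by (cases "B = []"; simp add: F')+
  have "tree_prod lam T T' \<in> free_module {G \<in> leaf_spaced_forests X.
      (is_Bullet T \<longrightarrow> is_Bullet (hd G)) \<and> (is_Bullet T' \<longrightarrow> is_Bullet (last G))}"
    by (rule tree_prod_leaf_spaced[OF T(1) T'(1)], intro conjI; rule less.hyps)
      (use T(1) T'(1) in \<open>auto simp: F F' size_list_append\<close>)
  then have "linear_ext (\<lambda>G. A @ G @ B) (tree_prod lam T T') \<in> free_module (leaf_spaced_forests X)"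
  proof (rule linear_ext_in_free_module)
    fix G
    assume "G \<in> {G \<in> leaf_spaced_forests X.
      (is_Bullet T \<longrightarrow> is_Bullet (hd G)) \<and> (is_Bullet T' \<longrightarrow> is_Bullet (last G))}"
    then have G: "G \<in> leaf_spaced_forests X" "is_Bullet T \<longrightarrow> is_Bullet (hd G)"
      "is_Bullet T' \<longrightarrow> is_Bullet (last G)"
      by simp_all
    then have "G \<noteq> []"
      by (auto dest: leaf_spaced_in_forests)
    with G(1,3) T' have "G @ B \<in> leaf_spaced_forests X"
      by (cases "B = []") (auto simp: leaf_spaced_append)
    with \<open>G \<noteq> []\<close> G(2) T show "A @ G @ B \<in> leaf_spaced_forests X"
      by (cases "A = []") (auto simp: leaf_spaced_append)
  qed
  then show ?case
    by (simp add: F F' forest_prod_conc linear_ext_append)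
qed

lemma forest_algebra_rota_baxter:
  fixes lam :: "'k::{comm_ring, comm_monoid_mult}" and X :: "'x set"
  shows "nonunitary_rota_baxter_algebra lam (forest_algebra lam X)"
proof -
  have "graft_op p \<in> free_module (leaf_spaced_forests X)"
    if "p \<in> free_module (leaf_spaced_forests X)" for p :: "'x forest \<Rightarrow>\<^sub>0 'k"
    unfolding graft_op_def by (rule linear_ext_in_free_module[OF that]) simp
  moreover have "fprod lam p q \<in> free_module (leaf_spaced_forests X)"
    if "p \<in> free_module (leaf_spaced_forests X)" "q \<in> free_module (leaf_spaced_forests X)" for p q
    by (rule bilinear_ext_in_free_module[OF that forest_prod_leaf_spaced])
  ultimately show ?thesis
    unfolding forest_algebra_def
    by unfold_locales
      (simp_all add: add_in_free_module uminus_in_free_module smul_in_free_module smul_add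
        smul_add_left smul_smul bilinear_ext_simps fprod_assoc graft_op_simps
        fprod_rota_baxter)
qed


section \<open>The universal property\<close>

text \<open>
  The value \<open>0\<close> at the empty forest mirrors the value \<open>0\<close> of \<open>forest_prod\<close> there, so that the
  extension is multiplicative on all lists of trees.
\<close>

function tree_eval :: "('k, 'a::ab_group_add) rb_struct \<Rightarrow> ('x \<Rightarrow> 'a) \<Rightarrow> 'x ptree \<Rightarrow> 'a"
  and forest_eval :: "('k, 'a) rb_struct \<Rightarrow> ('x \<Rightarrow> 'a) \<Rightarrow> 'x forest \<Rightarrow> 'a"
where
  "tree_eval R f (Bullet x) = f x"
| "tree_eval R f (Graft F) = rb_op R (forest_eval R f F)"
| "forest_eval R f [] = 0"
| "forest_eval R f [T] = tree_eval R f T"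
| "forest_eval R f (T # T' # F) = mult R (tree_eval R f T) (forest_eval R f (T' # F))"
  by pat_completeness auto
termination
  by (relation "measure (\<lambda>s. case s of Inl (_, _, T) \<Rightarrow> 2 * size T
      | Inr (_, _, F) \<Rightarrow> 2 * size_list size F + 1)") auto

lemma forest_eval_Cons:
  "F \<noteq> [] \<Longrightarrow> forest_eval R f (T # F) = mult R (tree_eval R f T) (forest_eval R f F)"
  by (cases F) auto

context nonunitary_rota_baxter_algebra
begin

lemma module_on_carr: "module_on (carr A) (scale A)"
  by unfold_locales
    (auto simp: zero_closed add_closed scale_closed scale_add_right scale_add_left scale_scale
      scale_one)

lemma mult_zero: "a \<in> carr A \<Longrightarrow> mult A 0 a = 0" "a \<in> carr A \<Longrightarrow> mult A a 0 = 0"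
  using mult_add_left[of 0 0 a] mult_add_right[of a 0 0] zero_closed by auto

lemma op_zero: "rb_op A 0 = 0"
  using op_add[of 0 0] zero_closed by auto

context
  fixes f :: "'x \<Rightarrow> 'a"
  assumes f: "\<And>x. f x \<in> carr A"
begin

lemma eval_closed:
  shows "tree_eval A f T \<in> carr A" and "forest_eval A f F \<in> carr A"
proof -
  have forest: "forest_eval A f F \<in> carr A" if "\<And>T. T \<in> set F \<Longrightarrow> tree_eval A f T \<in> carr A" for F
    using that
  proof (induction F)
    case (Cons T F)
    then show ?case
      by (cases "F = []") (simp_all add: forest_eval_Cons mult_closed)
  qed (simp add: zero_closed)
  show tree: "tree_eval A f T \<in> carr A" for T
    by (induction T) (simp_all add: f op_closed forest)
  show "forest_eval A f F \<in> carr A"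
    by (rule forest) (rule tree)
qed

lemma forest_eval_append:
  "F \<noteq> [] \<Longrightarrow> G \<noteq> [] \<Longrightarrow>
    forest_eval A f (F @ G) = mult A (forest_eval A f F) (forest_eval A f G)"
proof (induction F)
  case (Cons T F)
  then show ?case
    by (cases "F = []") (simp_all add: forest_eval_Cons mult_assoc eval_closed)
qed simp

definition eval :: "('x forest \<Rightarrow>\<^sub>0 'k) \<Rightarrow> 'a" where
  "eval = extend (scale A) (forest_eval A f)"

lemma eval_simps:
  "eval 0 = 0"
  "eval (p + q) = eval p + eval q"
  "eval (smul c p) = scale A c (eval p)"
  "eval (basis F) = forest_eval A f F"
  by (simp_all add: eval_def module_on.extend_add[OF module_on_carr]
      module_on.extend_smul[OF module_on_carr] module_on.extend_basis[OF module_on_carr] eval_closed)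
    (simp add: extend_def)

lemma eval_mem: "eval p \<in> carr A"
  by (simp add: eval_def module_on.extend_mem[OF module_on_carr] eval_closed)

lemma eval_graft_op: "eval (graft_op p) = rb_op A (eval p)"
  by (induction p rule: basis_induct)
    (simp_all add: graft_op_simps eval_simps op_zero op_add op_scale eval_mem eval_closed)

lemma eval_conc:
  assumes "p \<in> free_module {G. G \<noteq> []}" and "q \<in> free_module {G. G \<noteq> []}"
  shows "eval (conc p q) = mult A (eval p) (eval q)"
  using assms(1)
proof (induction p rule: free_module_induct)
  case (gen c F)
  from assms(2) show ?case
  proof (induction q rule: free_module_induct)
    case (gen d G)
    with \<open>F \<in> _\<close> show ?case
      by (simp add: conc_simps eval_simps eval_closed forest_eval_append mult_scale_left
          mult_scale_right scale_closed mult_closed)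
  qed (simp_all add: conc_simps eval_simps eval_mem eval_closed mult_zero mult_add_right
      scale_closed scale_add_right smul_add)
qed (simp_all add: conc_simps eval_simps eval_mem mult_zero mult_add_left)

text \<open>
  The recursion of \<open>tree_prod\<close> is matched by the Rota--Baxter identity of the target, and the
  clause for forests by associativity there.
\<close>

lemma eval_forest_prod:
  "eval (forest_prod lam F G) = mult A (forest_eval A f F) (forest_eval A f G)"
proof (induction "size_list size F + size_list size G" arbitrary: F G rule: less_induct)
  case less
  show ?case
  proof (cases "F = [] \<or> G = []")
    case True
    then show ?thesis
      by (auto simp: eval_simps mult_zero eval_closed)
  next
    case False
    then obtain F' T T' G' where F: "F = F' @ [T]" and G: "G = T' # G'"
      by (metis neq_Nil_conv rev_exhaust)
    have tree: "eval (tree_prod lam T T') = mult A (tree_eval A f T) (tree_eval A f T')"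
    proof (cases "is_Bullet T \<or> is_Bullet T'")
      case True
      then have "tree_prod lam T T' = basis [T, T']"
        by (cases T; cases T') auto
      then show ?thesis
        by (simp add: eval_simps)
    next
      case False
      then obtain H H' where T: "T = Graft H" "T' = Graft H'"
        by (metis is_Bullet.simps(1) ptree.exhaust)
      have "eval (forest_prod lam H [T']) = mult A (forest_eval A f H) (forest_eval A f [T'])"
        "eval (forest_prod lam [T] H') = mult A (forest_eval A f [T]) (forest_eval A f H')"
        "eval (forest_prod lam H H') = mult A (forest_eval A f H) (forest_eval A f H')"
        by (rule less; simp add: F G T)+
      then show ?thesis
        unfolding T tree_prod_Graft
        by (simp add: eval_simps eval_graft_op rota_baxter eval_closed)
    qed
    have nonempty: "basis F \<in> free_module {G. G \<noteq> []}" if "F \<noteq> []" for F :: "'x forest"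
      by (simp add: basis_in_free_module that)
    have right: "eval (conc (tree_prod lam T T') (basis G')) =
        mult A (tree_eval A f T) (forest_eval A f G)"
      by (cases "G' = []")
        (simp_all add: G tree eval_conc tree_prod_nonempty nonempty eval_simps forest_eval_Cons
          mult_assoc eval_closed)
    have "conc (tree_prod lam T T') (basis G') = forest_prod lam [T] G"
      using forest_prod_conc[of lam "[]" T T' G'] by (simp add: G)
    with right have eval_right: "eval (forest_prod lam [T] G) =
        mult A (tree_eval A f T) (forest_eval A f G)"
      by simp
    show ?thesis
    proof (cases "F' = []")
      case True
      with eval_right show ?thesis
        by (simp add: F)
    next
      case False
      then show ?thesis
        by (simp add: F forest_prod_append_left eval_conc nonempty forest_prod_nonempty eval_right
            eval_simps forest_eval_append mult_assoc eval_closed)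
    qed
  qed
qed

lemma eval_fprod: "eval (fprod lam p q) = mult A (eval p) (eval q)"
proof (induction p rule: basis_induct)
  case (gen c F)
  show ?case
    by (induction q rule: basis_induct)
      (simp_all add: bilinear_ext_simps eval_simps eval_mem eval_closed eval_forest_prod
        mult_zero mult_add_right mult_scale_left mult_scale_right mult_closed scale_closed
        scale_add_right smul_add)
qed (simp_all add: bilinear_ext_simps eval_simps eval_mem mult_zero mult_add_left)

lemma eval_morphism: "rb_morphism (forest_algebra lam X) A eval"
  by (simp add: rb_morphism_def forest_algebra_def eval_mem eval_simps eval_fprod eval_graft_op)

end

end

text \<open>
  In a leaf-spaced forest the first tree and the one after it are not both grafts, so the forest
  is the product of its first tree with the rest. Thus the leaf-spaced forests are generated by
  the one-vertex trees under product and grafting.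
\<close>

lemma rb_morphism_eq_on_forest_algebra:
  fixes R :: "('k::{comm_ring, comm_monoid_mult}, 'r::ab_group_add) rb_struct" and X :: "'x set"
  assumes R: "nonunitary_rota_baxter_algebra lam R"
    and g: "rb_morphism (forest_algebra lam X) R g"
    and h: "rb_morphism (forest_algebra lam X) R h"
    and gens: "\<And>x. x \<in> X \<Longrightarrow> g (j_map x) = h (j_map x)"
    and p: "p \<in> carr (forest_algebra lam X)"
  shows "g p = h p"
proof -
  interpret nonunitary_rota_baxter_algebra lam R by (rule R)
  let ?L = "leaf_spaced_forests X"
  have basis: "g (basis F) = h (basis F)" if "F \<in> forests X" "F \<in> ?L" for F
    using that
  proof (induction F rule: forests_induct)
    case (Bullet x)
    then show ?case using gens by (simp add: j_map_def)
  next
    case (Graft F)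
    then have "F \<in> ?L" by simp
    then have "basis F \<in> carr (forest_algebra lam X)"
      by (simp add: forest_algebra_def basis_in_free_module)
    with g h have "g (graft_op (basis F)) = rb_op R (g (basis F))"
      "h (graft_op (basis F)) = rb_op R (h (basis F))"
      by (auto simp: rb_morphism_def forest_algebra_def)
    with Graft show ?case by (simp add: graft_op_simps)
  next
    case (append T F)
    have "F \<noteq> []" using append by auto
    then have *: "[T] \<in> ?L" "F \<in> ?L" "is_Bullet T \<or> is_Bullet (hd F)"
      using append.prems leaf_spaced_append[of "[T]" F X] by simp_all
    obtain T' F' where "F = T' # F'" using \<open>F \<noteq> []\<close> by (cases F) auto
    with *(3) have "tree_prod lam T T' = basis [T, T']" by (cases T; cases T') auto
    with \<open>F = _\<close> have "forest_prod lam [T] F = basis (T # F)"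
      using forest_prod_conc[of lam "[]" T T' F'] by (simp add: conc_simps)
    then have "basis (T # F) = fprod lam (basis [T]) (basis F)"
      by (simp add: bilinear_ext_simps)
    moreover have "basis [T] \<in> free_module ?L" "basis F \<in> free_module ?L"
      using * by (simp_all add: basis_in_free_module)
    with g h have "g (fprod lam (basis [T]) (basis F)) = mult R (g (basis [T])) (g (basis F))"
      "h (fprod lam (basis [T]) (basis F)) = mult R (h (basis [T])) (h (basis F))"
      by (auto simp: rb_morphism_def forest_algebra_def)
    ultimately show ?case using append.IH * by simp
  qed
  have zero: "g 0 = 0" "h 0 = 0"
  proof -
    have "g (0 + 0) = g 0 + g 0" "h (0 + 0) = h 0 + h 0"
      using g h by (auto simp: rb_morphism_def forest_algebra_def simp del: add_0_right add_0_left)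
    then show "g 0 = 0" "h 0 = 0" by simp_all
  qed
  have "p \<in> free_module ?L" using p by (simp add: forest_algebra_def)
  then have "p \<in> free_module ?L \<and> g p = h p"
  proof (induction p rule: free_module_induct)
    case (add p q)
    with g h have "g (p + q) = g p + g q" "h (p + q) = h p + h q"
      by (auto simp: rb_morphism_def forest_algebra_def)
    with add show ?case by (simp add: add_in_free_module)
  next
    case (gen c F)
    then have F: "(basis F :: 'x forest \<Rightarrow>\<^sub>0 'k) \<in> free_module ?L" by (simp add: basis_in_free_module)
    with g h have "g (smul c (basis F)) = scale R c (g (basis F))"
      "h (smul c (basis F)) = scale R c (h (basis F))"
      by (auto simp: rb_morphism_def forest_algebra_def)
    with F gen basis show ?case by (simp add: smul_in_free_module leaf_spaced_in_forests)
  qed (simp add: zero)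
  then show ?thesis by simp
qed

lemma forest_algebra_free:
  fixes lam :: "'k::{comm_ring, comm_monoid_mult}" and X :: "'x set"
  shows "free_nonunitary_rota_baxter_algebra TYPE('r::ab_group_add) lam X (forest_algebra lam X) j_map"
  unfolding free_nonunitary_rota_baxter_algebra_def
proof (intro conjI allI impI)
  show "nonunitary_rota_baxter_algebra lam (forest_algebra lam X)"
    by (rule forest_algebra_rota_baxter)
  show "j_map \<in> X \<rightarrow> carr (forest_algebra lam X)"
    by (simp add: j_map_def forest_algebra_def basis_in_free_module)
next
  fix R :: "('k, 'r) rb_struct" and f
  let ?U = "forest_algebra lam X"
  assume R: "nonunitary_rota_baxter_algebra lam R" and f: "f \<in> X \<rightarrow> carr R"
  interpret nonunitary_rota_baxter_algebra lam R by (rule R)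
  interpret U: nonunitary_rota_baxter_algebra lam ?U by (rule forest_algebra_rota_baxter)
  \<comment> \<open>Zero outside \<open>X\<close>, so that trees with other decorations are evaluated inside the carrier.\<close>
  define f' where "f' x = (if x \<in> X then f x else 0)" for x
  have f': "f' x \<in> carr R" for x
    using f zero_closed by (auto simp: f'_def)
  define g where "g = restrict (eval f') (carr ?U)"
  have morphism: "rb_morphism ?U R g"
    using eval_morphism[of f' X, OF f']
    by (simp add: g_def rb_morphism_def U.add_closed U.scale_closed U.mult_closed U.op_closed
        Pi_iff)
  have j: "f x = g (j_map x)" if "x \<in> X" for x
    using that eval_simps(4)[of f', OF f']
    by (simp add: g_def j_map_def f'_def forest_algebra_def basis_in_free_module)
  show "\<exists>!g. g \<in> extensional (carr ?U) \<and> rb_morphism ?U R g \<and> (\<forall>x\<in>X. f x = g (j_map x))"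
  proof (rule ex1I)
    show "g \<in> extensional (carr ?U) \<and> rb_morphism ?U R g \<and> (\<forall>x\<in>X. f x = g (j_map x))"
      using morphism j by (simp add: g_def)
  next
    fix h
    assume h: "h \<in> extensional (carr ?U) \<and> rb_morphism ?U R h \<and> (\<forall>x\<in>X. f x = h (j_map x))"
    show "h = g"
    proof (rule extensionalityI)
      show "h p = g p" if "p \<in> carr ?U" for p
        by (rule rb_morphism_eq_on_forest_algebra[OF R _ morphism _ that]) (use h j in auto)
    qed (use h in \<open>auto simp: g_def\<close>)
  qed
qed

section \<open>Forests as peak-free paths\<close>

primrec tree_path :: "'x ptree \<Rightarrow> 'x path" where
  "tree_path (Bullet x) = [Level x]"
| "tree_path (Graft F) = raise_path (concat (map tree_path F))"

definition forest_path :: "'x forest \<Rightarrow> 'x path" where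
  "forest_path F = concat (map tree_path F)"

lemma forest_path_simps [simp]:
  "forest_path [] = []"
  "forest_path (T # F) = tree_path T @ forest_path F"
  "forest_path (F @ G) = forest_path F @ forest_path G"
  by (simp_all add: forest_path_def)

lemma tree_path_Graft: "tree_path (Graft F) = raise_path (forest_path F)"
  by (simp add: forest_path_def)

declare tree_path.simps(2) [simp del]

lemma tree_path_nonempty [simp]: "tree_path T \<noteq> []"
  by (cases T) (simp_all add: tree_path_Graft raise_path_def)

lemma forest_path_eq_Nil [simp]: "forest_path F = [] \<longleftrightarrow> F = []"
  by (cases F) auto

lemma hd_tree_path: "hd (tree_path T) = (case T of Bullet x \<Rightarrow> Level x | Graft F \<Rightarrow> Up)"
  and last_tree_path: "last (tree_path T) = (case T of Bullet x \<Rightarrow> Level x | Graft F \<Rightarrow> Down)"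
  by (cases T; simp add: tree_path_Graft raise_path_def)+

lemma hd_forest_path: "F \<noteq> [] \<Longrightarrow> hd (forest_path F) = hd (tree_path (hd F))"
  by (cases F) auto

lemma last_forest_path: "F \<noteq> [] \<Longrightarrow> last (forest_path F) = last (tree_path (last F))"
  by (cases F rule: rev_cases) auto

lemma altitude_0 [simp]: "altitude m 0 = 0"
  by (simp add: altitude_def)

lemma altitude_append: "altitude (m @ n) i = altitude m i + altitude n (i - length m)"
  by (simp add: altitude_def)

lemma altitude_beyond: "length m \<le> i \<Longrightarrow> altitude m i = altitude m (length m)"
  by (simp add: altitude_def)

lemma altitude_raise_path:
  "i \<le> length m \<Longrightarrow> altitude (raise_path m) (Suc i) = 1 + altitude m i"
  by (simp add: raise_path_def altitude_def)

lemma motzkin_nonneg: "m \<in> motzkin_paths X \<Longrightarrow> 0 \<le> altitude m i"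
  by (cases "i \<le> length m") (auto simp: motzkin_paths_def altitude_beyond[of m i])

lemma motzkin_closed: "m \<in> motzkin_paths X \<Longrightarrow> altitude m (length m) = 0"
  by (simp add: motzkin_paths_def)

lemma motzkin_append:
  assumes "m \<in> motzkin_paths X" and "n \<in> motzkin_paths X"
  shows "m @ n \<in> motzkin_paths X"
proof -
  have "0 \<le> altitude (m @ n) i" for i
    using motzkin_nonneg[OF assms(1)] motzkin_nonneg[OF assms(2)] by (simp add: altitude_append)
  moreover have "altitude (m @ n) (length (m @ n)) = 0"
    using motzkin_closed[OF assms(1)] motzkin_closed[OF assms(2)]
    by (simp add: altitude_append altitude_beyond[of m "length m + length n"])
  ultimately show ?thesis
    using assms by (auto simp: motzkin_paths_def)
qed

lemma altitude_raise_path_end: "altitude (raise_path m) (length m + 2) = altitude m (length m)"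
  by (simp add: raise_path_def altitude_def)

lemma motzkin_raise_path:
  assumes "m \<in> motzkin_paths X"
  shows "raise_path m \<in> motzkin_paths X" and "indecomposable (raise_path m)"
proof -
  have pos: "0 < altitude (raise_path m) i" if "0 < i" "i \<le> length m + 1" for i
    using that altitude_raise_path[of "i - 1" m] motzkin_nonneg[OF assms, of "i - 1"] by simp
  have "0 \<le> altitude (raise_path m) i" if "i \<le> length (raise_path m)" for i
  proof -
    have "i = 0 \<or> (0 < i \<and> i \<le> length m + 1) \<or> i = length m + 2"
      using that by (auto simp: raise_path_def)
    then show ?thesis
      using pos[of i] altitude_raise_path_end[of m] motzkin_closed[OF assms] by auto
  qed
  moreover have "length (raise_path m) = length m + 2"
    by (simp add: raise_path_def)
  moreover have "Level x \<in> set (raise_path m) \<longleftrightarrow> Level x \<in> set m" for x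
    by (simp add: raise_path_def)
  ultimately show "raise_path m \<in> motzkin_paths X"
    using altitude_raise_path_end[of m] assms by (simp add: motzkin_paths_def)
  show "indecomposable (raise_path m)"
    unfolding indecomposable_def
  proof (intro allI impI)
    fix i
    assume "0 < i \<and> i < length (raise_path m)"
    with pos[of i] show "altitude (raise_path m) i \<noteq> 0"
      by (simp add: raise_path_def)
  qed
qed

lemma Level_motzkin: "[Level x] \<in> motzkin_paths X \<longleftrightarrow> x \<in> X"
  by (auto simp: motzkin_paths_def altitude_def le_Suc_eq)

lemma forest_path_motzkin: "F \<in> forests X \<Longrightarrow> forest_path F \<in> motzkin_paths X"
  by (induction rule: forests_induct)
    (auto simp: Level_motzkin tree_path_Graft motzkin_raise_path(1) motzkin_append)

lemma tree_path_indecomposable: "[T] \<in> forests X \<Longrightarrow> indecomposable (tree_path T)"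
  by (cases T)
    (auto simp: indecomposable_def[of "[_]"] tree_path_Graft forests_simps
      intro!: motzkin_raise_path(2) forest_path_motzkin)

lemma peak_free_paths_iff:
  "m \<in> peak_free_paths X \<longleftrightarrow> m \<in> motzkin_paths X \<and> m \<noteq> [] \<and>
    successively (\<lambda>a b. \<not> (a = Up \<and> b = Down)) m"
  by (auto simp: peak_free_paths_def successively_conv_nth)

lemma valley_free_paths_iff:
  "m \<in> valley_free_paths X \<longleftrightarrow> m \<in> motzkin_paths X \<and>
    successively (\<lambda>a b. \<not> (a = Down \<and> b = Up)) m"
  by (auto simp: valley_free_paths_def successively_conv_nth)

lemma hd_last_forest_path:
  "F \<noteq> [] \<Longrightarrow> hd (forest_path F) \<noteq> Down" "F \<noteq> [] \<Longrightarrow> last (forest_path F) \<noteq> Up"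
  by (auto simp: hd_forest_path last_forest_path hd_tree_path last_tree_path split: ptree.split)

text \<open>
  A peak could arise only within a grafting, around an empty forest: the path of a nonempty forest
  neither begins with a down step nor ends with an up step.
\<close>

lemma forest_path_peak_free:
  assumes "F \<in> forests X"
  shows "forest_path F \<in> peak_free_paths X"
proof -
  have "successively (\<lambda>a b. \<not> (a = Up \<and> b = Down)) (forest_path F)"
    using assms
  proof (induction rule: forests_induct)
    case (Graft F)
    then have "F \<noteq> []"
      by auto
    with Graft hd_last_forest_path[of F] show ?case
      by (simp add: tree_path_Graft raise_path_def successively_append_iff successively_Cons)
  next
    case (append T F)
    then show ?case
      using hd_last_forest_path(2)[of "[T]"] by (simp add: successively_append_iff)
  qed simp
  with assms show ?thesis
    by (auto simp: peak_free_paths_iff forest_path_motzkin)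
qed

text \<open>
  A valley is a place where the path of a graft is followed by the path of a graft.
\<close>

lemma forest_path_valley_free_iff:
  assumes "F \<in> forests X"
  shows "forest_path F \<in> valley_free_paths X \<longleftrightarrow> F \<in> leaf_spaced_forests X"
proof -
  have "successively (\<lambda>a b. \<not> (a = Down \<and> b = Up)) (forest_path F) \<longleftrightarrow> F \<in> leaf_spaced_forests X"
    using assms
  proof (induction rule: forests_induct)
    case (Graft F)
    then have "F \<noteq> []"
      by auto
    with Graft show ?case
      by (simp add: tree_path_Graft raise_path_def successively_append_iff successively_Cons)
  next
    case (append T F)
    then have "F \<noteq> []"
      by auto
    moreover have "last (tree_path T) = Down \<longleftrightarrow> \<not> is_Bullet T" "hd (tree_path T) = Up \<longleftrightarrow> \<not> is_Bullet T"
      for T :: "'a ptree"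
      by (simp_all add: last_tree_path hd_tree_path split: ptree.split)
    ultimately show ?case
      using append leaf_spaced_append[of "[T]" F X]
      by (auto simp: successively_append_iff hd_forest_path)
  qed simp
  with assms show ?thesis
    by (auto simp: valley_free_paths_iff forest_path_motzkin)
qed

text \<open>
  An indecomposable nontrivial path returns to the axis only at its end, so the decomposition of a
  link product cuts it off.
\<close>

lemma first_return_append:
  assumes "n \<noteq> []" and "indecomposable n" and "altitude n (length n) = 0"
  shows "first_return (n @ m) = length n"
  unfolding first_return_def
proof (rule Least_equality)
  show "0 < length n \<and> (altitude (n @ m) (length n) = 0 \<or> length n = length (n @ m))"
    using assms by (simp add: altitude_append)
next
  fix i
  assume "0 < i \<and> (altitude (n @ m) i = 0 \<or> i = length (n @ m))"
  then have i: "0 < i" "altitude (n @ m) i = 0 \<or> i = length (n @ m)"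
    by simp_all
  show "length n \<le> i"
  proof (rule ccontr)
    assume "\<not> length n \<le> i"
    with i have "altitude n i = 0" "i < length n"
      by (simp_all add: altitude_append)
    with i assms(2) show False
      by (simp add: indecomposable_def)
  qed
qed

lemma decomposition_forest_path:
  assumes "set F \<subseteq> trees X"
  shows "decomposition (forest_path F) = map tree_path F"
  using assms
proof (induction F)
  case (Cons T F)
  then have T: "[T] \<in> forests X"
    by (simp add: forests_def)
  then have "first_return (tree_path T @ forest_path F) = length (tree_path T)"
    using motzkin_closed[OF forest_path_motzkin[OF T]]
    by (simp add: first_return_append tree_path_indecomposable)
  with Cons show ?case
    by (simp add: decomposition.simps[of "tree_path T @ forest_path F"])
qed (simp add: decomposition.simps[of "[]"])

text \<open>
  The path of a forest determines the paths of its trees, by decomposition; the rest is structural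
  induction.
\<close>

lemma tree_path_inj:
  assumes "S \<in> trees X" and "T \<in> trees X" and "tree_path S = tree_path T"
  shows "S = T"
  using assms
proof (induction S arbitrary: T rule: ptree.induct)
  case (Bullet x)
  then show ?case
    by (cases T) (auto simp: tree_path_Graft raise_path_def)
next
  case (Graft F)
  then obtain G where T: "T = Graft G"
    by (cases T) (auto simp: tree_path_Graft raise_path_def)
  with Graft.prems have FG: "set F \<subseteq> trees X" "set G \<subseteq> trees X"
    by (auto elim: trees.cases)
  from Graft.prems(3) T have "forest_path F = forest_path G"
    by (simp add: tree_path_Graft raise_path_def)
  with FG have "map tree_path F = map tree_path G"
    by (metis decomposition_forest_path)
  then have "F = G"
    using Graft.IH FG by (intro list.inj_map_strong[of F G tree_path tree_path]) auto
  with T show ?case by simp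
qed

lemma forest_path_inj: "inj_on forest_path (forests X)"
proof (rule inj_onI)
  fix F G
  assume FG: "F \<in> forests X" "G \<in> forests X" "forest_path F = forest_path G"
  then have "tree_path (Graft F) = tree_path (Graft G)"
    by (simp add: tree_path_Graft)
  moreover have "Graft F \<in> trees X" "Graft G \<in> trees X"
    using FG by (auto simp: forests_def intro: trees.graft)
  ultimately show "F = G"
    using tree_path_inj by blast
qed

text \<open>
  If the first step is up, the path stays at height at least \<open>1\<close> until its last vertex, so
  its last step is down and the part in between, lowered by \<open>1\<close>, is again a Motzkin path.
\<close>

lemma indecomposable_cases:
  assumes "n \<in> motzkin_paths X" and "n \<noteq> []" and "indecomposable n"
  obtains (Level) x where "x \<in> X" and "n = [Level x]"
  | (raise) m where "m \<in> motzkin_paths X" and "n = raise_path m"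
proof -
  obtain a k where n: "n = a # k"
    using assms(2) by (cases n) auto
  have alt1: "altitude n (Suc 0) = rise a"
    by (simp add: n altitude_def)
  show thesis
  proof (cases a)
    case (Level x)
    with assms(3) alt1 have "k = []"
      by (auto simp: indecomposable_def n)
    with Level n assms(1) show ?thesis
      by (intro that(1)[of x]) (simp_all add: Level_motzkin)
  next
    case Down
    with alt1 motzkin_nonneg[OF assms(1), of "Suc 0"] show ?thesis
      by simp
  next
    case Up
    with motzkin_closed[OF assms(1)] n have "k \<noteq> []"
      by (auto simp: altitude_def)
    then obtain m b where k: "k = m @ [b]"
      using rev_exhaust by blast
    have inner: "altitude n (Suc i) = 1 + altitude m i" if "i \<le> length m" for i
      using that by (simp add: n k Up altitude_def)
    have pos: "0 < altitude n (Suc i)" if "i \<le> length m" for i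
    proof -
      have "altitude n (Suc i) \<noteq> 0"
        using assms(3) that by (simp add: indecomposable_def n k)
      then show ?thesis
        using motzkin_nonneg[OF assms(1), of "Suc i"] by simp
    qed
    have total: "1 + altitude m (length m) + rise b = 0"
      using motzkin_closed[OF assms(1)] by (simp add: n k Up altitude_def)
    have b: "b = Down"
      using total pos[of "length m"] inner[of "length m"] by (cases b) auto
    have "0 \<le> altitude m i" if "i \<le> length m" for i
      using pos[OF that] inner[OF that] by simp
    with total b assms(1) have "m \<in> motzkin_paths X"
      by (auto simp: motzkin_paths_def n k)
    then show ?thesis
      by (intro that(2)[of m]) (simp_all add: n k Up b raise_path_def)
  qed
qed

text \<open>
  Each indecomposable component is a level step, which is the path of a leaf, or encloses a
  shorter path. The enclosed path is nontrivial because there are no peaks, so the induction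
  hypothesis applies to it.
\<close>

lemma peak_free_path_is_forest_path:
  assumes "m \<in> peak_free_paths X"
  shows "\<exists>F\<in>forests X. forest_path F = m"
  using assms
proof (induction "length m" arbitrary: m rule: less_induct)
  case less
  have "\<exists>T\<in>trees X. tree_path T = n" if n: "n \<in> set (decomposition m)" for n
  proof -
    have "n \<in> motzkin_paths X" "n \<noteq> []" "indecomposable n"
      using decomposition_indecomposable[OF _ n] less.prems by (auto simp: peak_free_paths_iff)
    then show ?thesis
    proof (cases rule: indecomposable_cases)
      case (Level x)
      then show ?thesis
        by (intro bexI[of _ "Bullet x"]) (auto intro: trees.bullet)
    next
      case (raise k)
      obtain ns ns' where "decomposition m = ns @ n # ns'"
        using n by (auto simp: in_set_conv_decomp)
      then have "m = concat ns @ n @ concat ns'"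
        using concat_decomposition[of m] by simp
      with less.prems have "successively (\<lambda>a b. \<not> (a = Up \<and> b = Down)) n"
        by (auto simp: peak_free_paths_iff successively_append_iff)
      with raise have "k \<noteq> []" "successively (\<lambda>a b. \<not> (a = Up \<and> b = Down)) k"
        by (auto simp: raise_path_def successively_append_iff successively_Cons)
      with raise have k: "k \<in> peak_free_paths X"
        by (simp add: peak_free_paths_iff)
      have "length k < length m"
        using length_decomposition_le[OF n] raise by (simp add: raise_path_def)
      from less.hyps[OF this k] obtain F where F: "F \<in> forests X" "forest_path F = k"
        by blast
      then have "Graft F \<in> trees X" "tree_path (Graft F) = n"
        using raise by (auto simp: forests_def tree_path_Graft intro: trees.graft)
      then show ?thesis
        by blast
    qed
  qed
  then obtain t where t: "\<And>n. n \<in> set (decomposition m) \<Longrightarrow> t n \<in> trees X \<and> tree_path (t n) = n"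
    by metis
  then have "map (\<lambda>n. tree_path (t n)) (decomposition m) = decomposition m"
    by (intro map_idI) simp
  then have "forest_path (map t (decomposition m)) = m"
    by (simp add: forest_path_def comp_def concat_decomposition)
  moreover have "map t (decomposition m) \<in> forests X"
    using t less.prems
    by (auto simp: forests_def peak_free_paths_iff decomposition_eq_Nil_iff)
  ultimately show ?case
    by blast
qed

lemma bij_betw_forest_path: "bij_betw forest_path (forests X) (peak_free_paths X)"
  unfolding bij_betw_def
  using forest_path_inj[of X] forest_path_peak_free peak_free_path_is_forest_path
  by blast

text \<open>
  The inverse of \<open>forest_path\<close> satisfies the description that defines \<open>phi_LF\<close>, and
  induction on forests shows that every map satisfying it inverts \<open>forest_path\<close>.
\<close>

lemma phi_LF_forest_path:
  assumes "F \<in> forests X"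
  shows "phi_LF X (forest_path F) = F"
proof -
  let ?P = "\<lambda>h. h \<in> extensional (peak_free_paths X) \<and>
        bij_betw h (peak_free_paths X) (forests X) \<and>
        (\<forall>m\<in>peak_free_paths X. \<forall>m'\<in>peak_free_paths X. h (m @ m') = h m @ h m') \<and>
        (\<forall>x\<in>X. h [Level x] = [Bullet x]) \<and>
        (\<forall>m\<in>peak_free_paths X. h (raise_path m) = [Graft (h m)])"
  define \<phi> where "\<phi> = restrict (the_inv_into (forests X) forest_path) (peak_free_paths X)"
  have \<phi>: "\<phi> (forest_path F) = F" if "F \<in> forests X" for F
    using that by (simp add: \<phi>_def forest_path_peak_free the_inv_into_f_f forest_path_inj)
  have peak_free: "\<exists>F\<in>forests X. m = forest_path F" if "m \<in> peak_free_paths X" for m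
    using peak_free_path_is_forest_path[OF that] by blast
  have "?P \<phi>"
  proof (intro conjI ballI)
    show "\<phi> \<in> extensional (peak_free_paths X)"
      by (simp add: \<phi>_def)
    show "bij_betw \<phi> (peak_free_paths X) (forests X)"
      unfolding \<phi>_def by (simp add: bij_betw_the_inv_into bij_betw_forest_path)
  next
    fix m m'
    assume "m \<in> peak_free_paths X" "m' \<in> peak_free_paths X"
    then obtain F F' where F: "F \<in> forests X" "m = forest_path F" "F' \<in> forests X" "m' = forest_path F'"
      using peak_free by blast
    then have "F @ F' \<in> forests X"
      by (auto simp: forests_def)
    from \<phi>[OF this] F show "\<phi> (m @ m') = \<phi> m @ \<phi> m'"
      by (simp add: \<phi>)
  next
    fix x
    assume "x \<in> X"
    with \<phi>[of "[Bullet x]"] show "\<phi> [Level x] = [Bullet x]"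
      by (simp add: forests_simps)
  next
    fix m
    assume "m \<in> peak_free_paths X"
    then obtain F where F: "F \<in> forests X" "m = forest_path F"
      using peak_free by blast
    with \<phi>[of "[Graft F]"] show "\<phi> (raise_path m) = [Graft (\<phi> m)]"
      by (simp add: forests_simps tree_path_Graft \<phi>)
  qed
  moreover have "h = \<phi>" if h: "?P h" for h
  proof (rule extensionalityI)
    have h_inverse: "h (forest_path F) = F" if "F \<in> forests X" for F
      using that
    proof (induction rule: forests_induct)
      case (append T F)
      have "h (forest_path [T] @ forest_path F) = h (forest_path [T]) @ h (forest_path F)"
        using h append.hyps forest_path_peak_free by blast
      with append show ?case
        by simp
    qed (use h in \<open>auto simp: tree_path_Graft forest_path_peak_free\<close>)
    show "h m = \<phi> m" if "m \<in> peak_free_paths X" for m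
      using peak_free[OF that] h_inverse \<phi> by auto
    show "h \<in> extensional (peak_free_paths X)" "\<phi> \<in> extensional (peak_free_paths X)"
      using h by (simp_all add: \<phi>_def)
  qed
  ultimately have "phi_LF X = \<phi>"
    unfolding phi_LF_def by (rule the_equality)
  with \<phi>[OF assms] show ?thesis
    by simp
qed

lemma forest_path_image_leaf_spaced:
  "forest_path ` leaf_spaced_forests X = peak_free_paths X \<inter> valley_free_paths X"
proof (intro equalityI subsetI)
  fix m
  assume "m \<in> peak_free_paths X \<inter> valley_free_paths X"
  then show "m \<in> forest_path ` leaf_spaced_forests X"
    using peak_free_path_is_forest_path[of m X] forest_path_valley_free_iff by blast
qed (auto simp: forest_path_peak_free forest_path_valley_free_iff leaf_spaced_in_forests)

lemma phi_LV_Fl_forest_path: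
  assumes "F \<in> leaf_spaced_forests X"
  shows "phi_LV_Fl X (forest_path F) = F"
proof -
  have "forest_path F \<in> peak_free_paths X \<inter> valley_free_paths X"
    using assms forest_path_image_leaf_spaced by blast
  with assms show ?thesis
    by (simp add: phi_LV_Fl_def phi_LF_forest_path leaf_spaced_in_forests)
qed

lemma bij_betw_phi_LV_Fl:
  "bij_betw (phi_LV_Fl X) (peak_free_paths X \<inter> valley_free_paths X) (leaf_spaced_forests X)"
  unfolding forest_path_image_leaf_spaced[symmetric]
  by (rule bij_betw_byWitness[where f' = forest_path]) (auto simp: phi_LV_Fl_forest_path)


section \<open>Transport of the Rota--Baxter structure\<close>

text \<open>
  Both products are defined by the same recursion, since \<open>forest_path\<close> turns grafting into
  raising and the list of trees into the decomposition. The empty forest has to be excluded: the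
  trivial path is the identity of the path product, whereas the forest product vanishes there.
\<close>

lemma path_prod_forest_path:
  fixes lam :: "'k::{comm_ring, comm_monoid_mult}" and F F' :: "'x forest"
  assumes "F \<in> forests X" and "F' \<in> forests X"
  shows "path_prod lam (forest_path F) (forest_path F') =
    linear_ext forest_path (forest_prod lam F F')"
  using assms
proof (induction "size_list size F + size_list size F'" arbitrary: F F' rule: less_induct)
  case less
  have "F \<noteq> []" "F' \<noteq> []"
    using less.prems by auto
  then obtain A T T' B where F: "F = A @ [T]" and F': "F' = T' # B"
    by (metis neq_Nil_conv rev_exhaust)
  have T: "[T] \<in> forests X" "[T'] \<in> forests X"
    using less.prems by (auto simp: forests_def F F')
  have indec: "indec_prod lam (tree_path T) (tree_path T') =
      linear_ext forest_path (tree_prod lam T T')"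
  proof (cases "is_Bullet T \<or> is_Bullet T'")
    case True
    then have "tree_prod lam T T' = basis [T, T']"
      by (cases T; cases T') auto
    moreover have "indec_prod lam (tree_path T) (tree_path T') = basis (tree_path T @ tree_path T')"
    proof -
      have "(\<exists>x. tree_path T = [Level x]) \<or> (\<exists>x. tree_path T' = [Level x])"
        using True by (cases T; cases T') simp_all
      then show ?thesis
        unfolding indec_prod.simps[of lam "tree_path T" "tree_path T'"] by (simp only: if_True simp_thms)
    qed
    ultimately show ?thesis
      by (simp add: linear_ext_simps)
  next
    case False
    then obtain G G' where G: "T = Graft G" "T' = Graft G'"
      by (metis is_Bullet.simps(1) ptree.exhaust)
    with T have forests: "G \<in> forests X" "G' \<in> forests X"
      by (simp_all add: forests_simps)
    have IH: "path_prod lam (forest_path G) (forest_path [T']) =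
          linear_ext forest_path (forest_prod lam G [T'])"
        "path_prod lam (forest_path [T]) (forest_path G') =
          linear_ext forest_path (forest_prod lam [T] G')"
        "path_prod lam (forest_path G) (forest_path G') =
          linear_ext forest_path (forest_prod lam G G')"
      by (rule less.hyps; use T forests in \<open>simp add: F F' G\<close>)+
    have not_Level: "tree_path (Graft H) \<noteq> [Level x]" for H :: "'x forest" and x
      by (simp add: tree_path_Graft raise_path_def)
    have raise: "linear_ext raise_path (linear_ext forest_path p) =
        linear_ext forest_path (linear_ext (\<lambda>G. [Graft G]) p)" for p :: "'x forest \<Rightarrow>\<^sub>0 'k"
      by (simp add: linear_ext_compose tree_path_Graft)
    have "indec_prod lam (tree_path T) (tree_path T') =
        linear_ext raise_path (path_prod lam (forest_path G) (forest_path [T']))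
        + linear_ext raise_path (path_prod lam (forest_path [T]) (forest_path G'))
        + smul lam (linear_ext raise_path (path_prod lam (forest_path G) (forest_path G')))"
      unfolding G indec_prod.simps[of lam "tree_path (Graft G)"]
      by (simp add: not_Level) (simp add: tree_path_Graft)
    also have "\<dots> = linear_ext forest_path (tree_prod lam T T')"
      unfolding IH raise by (simp add: G linear_ext_simps)
    finally show ?thesis .
  qed
  have "decomposition (forest_path F) = map tree_path F"
    "decomposition (forest_path F') = map tree_path F'"
    using less.prems by (auto simp: forests_def intro!: decomposition_forest_path)
  with \<open>F \<noteq> []\<close> \<open>F' \<noteq> []\<close> show ?case
    unfolding path_prod.simps[of lam "forest_path F"] forest_prod.simps[of lam F]
    by (simp add: F F' indec linear_ext_compose butlast_append flip: forest_path_def)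
qed

lemma path_prod_linear_ext:
  assumes "p \<in> free_module (forests X)" and "q \<in> free_module (forests X)"
  shows "linear_ext forest_path (fprod lam p q) =
    bilinear_ext (path_prod lam) (linear_ext forest_path p) (linear_ext forest_path q)"
  using assms(1)
proof (induction p rule: free_module_induct)
  case (gen c F)
  from assms(2) show ?case
    by (induction q rule: free_module_induct)
      (simp_all add: bilinear_ext_simps linear_ext_simps path_prod_forest_path[where X = X] gen smul_add)
qed (simp_all add: bilinear_ext_simps linear_ext_simps)

lemma forest_path_morphism:
  fixes lam :: "'k::{comm_ring, comm_monoid_mult}" and X :: "'x set"
  shows "rb_morphism (forest_algebra lam X) (path_algebra lam X) (linear_ext forest_path)"
proof -
  have "linear_ext forest_path p \<in> free_module (peak_free_paths X \<inter> valley_free_paths X)"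
    if "p \<in> free_module (leaf_spaced_forests X)" for p :: "'x forest \<Rightarrow>\<^sub>0 'k"
    using that
    by (rule linear_ext_in_free_module) (use forest_path_image_leaf_spaced in blast)
  moreover have "leaf_spaced_forests X \<subseteq> forests X"
    by (auto simp: leaf_spaced_in_forests)
  ultimately show ?thesis
    by (auto simp: rb_morphism_def forest_algebra_def path_algebra_def linear_ext_simps
        path_prod_linear_ext[where X = X] free_module_mono graft_op_def raise_op_def
        linear_ext_compose tree_path_Graft)
qed

lemma linear_ext_phi_inverse:
  "p \<in> free_module (leaf_spaced_forests X) \<Longrightarrow>
    linear_ext (phi_LV_Fl X) (linear_ext forest_path p) = p"
  "q \<in> free_module (peak_free_paths X \<inter> valley_free_paths X) \<Longrightarrow>
    linear_ext forest_path (linear_ext (phi_LV_Fl X) q) = q"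
proof -
  assume "p \<in> free_module (leaf_spaced_forests X)"
  then have "linear_ext (\<lambda>F. phi_LV_Fl X (forest_path F)) p = linear_ext (\<lambda>F. F) p"
    by (rule linear_ext_cong_on) (rule phi_LV_Fl_forest_path)
  then show "linear_ext (phi_LV_Fl X) (linear_ext forest_path p) = p"
    by (simp add: linear_ext_compose linear_ext_id)
next
  assume "q \<in> free_module (peak_free_paths X \<inter> valley_free_paths X)"
  then have "linear_ext (\<lambda>m. forest_path (phi_LV_Fl X m)) q = linear_ext (\<lambda>m. m) q"
    unfolding forest_path_image_leaf_spaced[symmetric]
    by (rule linear_ext_cong_on) (auto simp: phi_LV_Fl_forest_path)
  then show "linear_ext forest_path (linear_ext (phi_LV_Fl X) q) = q"
    by (simp add: linear_ext_compose linear_ext_id)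
qed

lemma rb_morphism_surj_transport:
  assumes A: "nonunitary_rota_baxter_algebra lam A" and g: "rb_morphism A B g"
    and surj: "carr B = g ` carr A"
  shows "nonunitary_rota_baxter_algebra lam B"
proof -
  interpret nonunitary_rota_baxter_algebra lam A by (rule A)
  have hom: "a \<in> carr A \<Longrightarrow> b \<in> carr A \<Longrightarrow> g a + g b = g (a + b)"
    "a \<in> carr A \<Longrightarrow> scale B c (g a) = g (scale A c a)"
    "a \<in> carr A \<Longrightarrow> b \<in> carr A \<Longrightarrow> mult B (g a) (g b) = g (mult A a b)"
    "a \<in> carr A \<Longrightarrow> rb_op B (g a) = g (rb_op A a)" for a b c
    using g by (simp_all add: rb_morphism_def)
  have zero: "0 = g 0"
    using hom(1)[of 0 0] zero_closed by simp
  have uminus: "- g a = g (- a)" if "a \<in> carr A" for a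
    using hom(1)[OF that uminus_closed[OF that]] zero by (simp add: minus_unique)
  note closed = zero_closed add_closed uminus_closed scale_closed mult_closed op_closed
  show ?thesis
  proof unfold_locales
    show "0 \<in> carr B"
      unfolding surj using zero zero_closed by (rule image_eqI)
  qed (auto simp: surj hom closed uminus scale_add_right scale_add_left scale_scale scale_one
      mult_add_left mult_add_right mult_scale_left mult_scale_right mult_assoc op_add op_scale
      rota_baxter)
qed

lemma rb_morphism_inverse:
  assumes A: "nonunitary_rota_baxter_algebra lam A" and g: "rb_morphism A B g"
    and h: "h \<in> carr B \<rightarrow> carr A" and hg: "\<And>a. a \<in> carr A \<Longrightarrow> h (g a) = a"
    and gh: "\<And>b. b \<in> carr B \<Longrightarrow> g (h b) = b"
  shows "rb_isomorphism B A h"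
proof -
  interpret nonunitary_rota_baxter_algebra lam A by (rule A)
  have g_closed: "g a \<in> carr B" if "a \<in> carr A" for a
    using g that by (auto simp: rb_morphism_def)
  have ex: "\<exists>a\<in>carr A. b = g a" if "b \<in> carr B" for b
    using gh[OF that] h that by (intro bexI[of _ "h b"]) auto
  have hom: "a \<in> carr A \<Longrightarrow> b \<in> carr A \<Longrightarrow> g a + g b = g (a + b)"
    "a \<in> carr A \<Longrightarrow> scale B c (g a) = g (scale A c a)"
    "a \<in> carr A \<Longrightarrow> b \<in> carr A \<Longrightarrow> mult B (g a) (g b) = g (mult A a b)"
    "a \<in> carr A \<Longrightarrow> rb_op B (g a) = g (rb_op A a)" for a b c
    using g by (simp_all add: rb_morphism_def)
  have "rb_morphism B A h"
    unfolding rb_morphism_def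
    using h by (auto dest!: ex simp: hom hg add_closed scale_closed mult_closed op_closed)
  moreover have "bij_betw h (carr B) (carr A)"
    by (rule bij_betw_byWitness[where f' = g]) (use h g_closed hg gh in auto)
  ultimately show ?thesis
    by (simp add: rb_isomorphism_def)
qed

theorem corollary6p5:
  fixes lam :: "'k::{comm_ring, comm_monoid_mult}" and X :: "'x set"
  assumes "X \<noteq> {}"
  shows "(bij_betw (phi_LV_Fl X) (peak_free_paths X \<inter> valley_free_paths X) (leaf_spaced_forests X) \<and>
          nonunitary_rota_baxter_algebra lam (path_algebra lam X) \<and>
          nonunitary_rota_baxter_algebra lam (forest_algebra lam X) \<and>
          rb_isomorphism (path_algebra lam X) (forest_algebra lam X) (linear_ext (phi_LV_Fl X))) \<and>
         free_nonunitary_rota_baxter_algebra TYPE('r::ab_group_add) lam X (forest_algebra lam X) j_map"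
proof (intro conjI)
  let ?\<phi> = "linear_ext (phi_LV_Fl X) :: ('x path \<Rightarrow>\<^sub>0 'k) \<Rightarrow> ('x forest \<Rightarrow>\<^sub>0 'k)"
  let ?\<psi> = "linear_ext forest_path :: ('x forest \<Rightarrow>\<^sub>0 'k) \<Rightarrow> ('x path \<Rightarrow>\<^sub>0 'k)"
  let ?A = "forest_algebra lam X" and ?B = "path_algebra lam X"
  show "bij_betw (phi_LV_Fl X) (peak_free_paths X \<inter> valley_free_paths X) (leaf_spaced_forests X)"
    by (rule bij_betw_phi_LV_Fl)
  show A: "nonunitary_rota_baxter_algebra lam ?A"
    by (rule forest_algebra_rota_baxter)
  show "free_nonunitary_rota_baxter_algebra TYPE('r) lam X ?A j_map"
    by (rule forest_algebra_free)
  have \<phi>: "?\<phi> \<in> carr ?B \<rightarrow> carr ?A"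
    using bij_betw_phi_LV_Fl[of X]
    by (auto simp: forest_algebra_def path_algebra_def bij_betw_def
        intro!: linear_ext_in_free_module)
  have \<psi>: "?\<psi> \<in> carr ?A \<rightarrow> carr ?B"
    using forest_path_morphism[of lam X] by (simp add: rb_morphism_def)
  have inverse: "?\<phi> (?\<psi> p) = p" if "p \<in> carr ?A" for p
    using that by (simp add: forest_algebra_def linear_ext_phi_inverse(1))
  have inverse': "?\<psi> (?\<phi> q) = q" if "q \<in> carr ?B" for q
    using that by (simp add: path_algebra_def linear_ext_phi_inverse(2))
  show "rb_isomorphism ?B ?A ?\<phi>"
    by (rule rb_morphism_inverse[OF A forest_path_morphism \<phi> inverse inverse'])
  have "carr ?B = ?\<psi> ` carr ?A"
    using \<phi> \<psi> inverse' by (auto simp: image_iff Pi_iff) (metis inverse')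
  with A forest_path_morphism show "nonunitary_rota_baxter_algebra lam ?B"
    by (rule rb_morphism_surj_transport)
qed

end
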